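(* Let $E\in Ob(\mathcal P)$. The functor $V_E$ is the preimage of the origin of the affine space $\mathcal P^2_{sch}(E,E)$ under the morphism $\mathrm{courb}:\mathcal P^1_{sch}(E,E)\to\mathcal P^2_{sch}(E,E)$. Consequently, $V_E$ is represented by the affine scheme $$V_E=\mathrm{Spec}\left(\frac{k[x_1,\ldots,x_r]}{\mathcal I}\right),$$ where $\mathcal I$ is the ideal generated by the elements $$\mathrm{courb}^{*}(y_l)=\sum_{i=1}^r b^i_l x_i+\sum_{i=1}^r\sum_{j=1}^r a^{ij}_l x_i x_j,\qquad l=1,\ldots,s.$$
   Context: Standing assumptions: $k$ is an algebraically closed field of characteristic $0$ and $\mathcal P$ is a fixed $k$-linear dg-category (cohomological grading, $d$ of degree $+1$, $d(\beta\alpha)=d(\beta)\alpha+(-1)^{|\beta|}\beta\,d(\alpha)$) such that (1) $Ob(\mathcal P)$ is finite; (2) for all objects $E,F$ and all $i\in\mathbb Z$, $\mathcal P^i(E,F)$ is a finite-dimensional $k$-vector space; (3) there is $n>0$ such that $\mathcal P^i(E,F)=0$ for all $E,F$ and all $i<-n$. Fix $E\in Ob(\mathcal P)$. Choose $k$-bases $e^1,\ldots,e^r$ of $\mathcal P^1(E,E)$ and $f^1,\ldots,f^s$ of $\mathcal P^2(E,E)$. Define structure constants $a^{ij}_l,b^i_l\in k$ by $$e^ie^j=\sum_{l=1}^s a^{ij}_l f^l,\qquad d(e^i)=\sum_{l=1}^s b^i_l f^l .$$ Put $\mathcal P^1_{sch}(E,E):=\mathrm{Spec}(k[x_1,\ldots,x_r])$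 and $\mathcal P^2_{sch}(E,E):=\mathrm{Spec}(k[y_1,\ldots,y_s])$; for a commutative $k$-algebra $B$ their $B$-points are identified via the bases with $\mathcal P^1(E,E)\otimes_k B$ and $\mathcal P^2(E,E)\otimes_k B$. The morphism $\mathrm{courb}:\mathcal P^1_{sch}(E,E)\to\mathcal P^2_{sch}(E,E)$ is given on $B$-points by $\eta\mapsto d(\eta)+\eta\eta$, where $d$ and the product are extended $B$-linearly from $\mathcal P$. $V_E$ is the functor from commutative $k$-algebras to sets given by $$V_E(B)=\{\sigma\in\mathcal P^1(E,E)\otimes_k B:\ d(\sigma)+\sigma^2=0\}.$$ *)

theory Defs
  imports
    "HOL-Algebra.Algebraic_Closure_Type"
    "HOL-Algebra.Free_Abelian_Groups"
    "HOL-Algebra.QuotRing"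
    "HOL-Algebra.Module"
begin

section \<open>Vector spaces, commutative algebras and polynomial algebras over a field\<close>

text \<open>The ground field is a type; vector spaces and algebras over it are records with carriers.\<close>

abbreviation ground :: "'k::field ring"
  where "ground \<equiv> ring_of_type_algebra"

definition is_basis :: "('k::field, 'v) module \<Rightarrow> nat \<Rightarrow> (nat \<Rightarrow> 'v) \<Rightarrow> bool"
  where "is_basis M n e \<longleftrightarrow>
    e \<in> {1..n} \<rightarrow> carrier M \<and>
    (\<forall>v\<in>carrier M. \<exists>!c. c \<in> {1..n} \<rightarrow>\<^sub>E (UNIV :: 'k set) \<and>
       v = (\<Oplus>\<^bsub>M\<^esub> i\<in>{1..n}. c i \<odot>\<^bsub>M\<^esub> e i))"

definition finite_dimensional :: "('k::field, 'v) module \<Rightarrow> bool"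
  where "finite_dimensional M \<longleftrightarrow> (\<exists>n e. is_basis M n e)"

abbreviation comm_alg :: "('k::field, 'u) module \<Rightarrow> bool"
  where "comm_alg B \<equiv> algebra ground B"

text \<open>Homomorphisms are taken extensional, so that equality of functions is equality of
  homomorphisms.\<close>

definition alg_hom :: "('k::field, 'a) module \<Rightarrow> ('k, 'b) module \<Rightarrow> ('a \<Rightarrow> 'b) set"
  where "alg_hom A B =
    {h \<in> ring_hom A B \<inter> extensional (carrier A).
       \<forall>c. \<forall>x\<in>carrier A. h (c \<odot>\<^bsub>A\<^esub> x) = c \<odot>\<^bsub>B\<^esub> h x}"

definition alg_id :: "('k::field, 'a) module \<Rightarrow> 'a \<Rightarrow> 'a"
  where "alg_id A = restrict (\<lambda>x. x) (carrier A)"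

type_synonym 'k mpoly = "(nat \<Rightarrow>\<^sub>0 nat) \<Rightarrow>\<^sub>0 'k"

definition poly_const :: "'k::field \<Rightarrow> 'k mpoly"
  where "poly_const c = Poly_Mapping.single 0 c"

definition poly_var :: "nat \<Rightarrow> 'k::field mpoly"
  where "poly_var i = Poly_Mapping.single (Poly_Mapping.single i 1) 1"

text \<open>The polynomial algebra in the variables with indices \<open>1, \<dots>, n\<close>; the multiplication of
  \<^typ>\<open>'k mpoly\<close> is convolution.\<close>

definition poly_alg :: "nat \<Rightarrow> ('k::field, 'k mpoly) module"
  where "poly_alg n =
    \<lparr>carrier = {p. \<forall>m\<in>Poly_Mapping.keys p. Poly_Mapping.keys m \<subseteq> {1..n}},
     monoid.mult = (*), monoid.one = 1, ring.zero = 0, ring.add = (+),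
     module.smult = (\<lambda>c p. poly_const c * p)\<rparr>"

definition quot_alg :: "('k::field, 'a) module \<Rightarrow> 'a set \<Rightarrow> ('k, 'a set) module"
  where "quot_alg A I =
    ring.extend (A Quot I)
      (module.fields (\<lambda>c S. \<Union>x\<in>S. I +>\<^bsub>A\<^esub> (c \<odot>\<^bsub>A\<^esub> x)))"


section \<open>Tensor products over the ground field\<close>

text \<open>The tensor product is the free abelian group on pairs modulo the biadditivity and balancing
  relations.\<close>

definition tensor_free :: "('k::field, 'v) module \<Rightarrow> ('k, 'u) module \<Rightarrow> ('v \<times> 'u \<Rightarrow>\<^sub>0 int) monoid"
  where "tensor_free M N = free_Abelian_group (carrier M \<times> carrier N)"

definition tensor_rel :: "('k::field, 'v) module \<Rightarrow> ('k, 'u) module \<Rightarrow> ('v \<times> 'u \<Rightarrow>\<^sub>0 int) set"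
  where "tensor_rel M N = generate (tensor_free M N)
    ({frag_of (x \<oplus>\<^bsub>M\<^esub> x', y) - frag_of (x, y) - frag_of (x', y) | x x' y.
        x \<in> carrier M \<and> x' \<in> carrier M \<and> y \<in> carrier N} \<union>
     {frag_of (x, y \<oplus>\<^bsub>N\<^esub> y') - frag_of (x, y) - frag_of (x, y') | x y y'.
        x \<in> carrier M \<and> y \<in> carrier N \<and> y' \<in> carrier N} \<union>
     {frag_of (c \<odot>\<^bsub>M\<^esub> x, y) - frag_of (x, c \<odot>\<^bsub>N\<^esub> y) | c x y.
        x \<in> carrier M \<and> y \<in> carrier N})"

definition tensor_class ::
    "('k::field, 'v) module \<Rightarrow> ('k, 'u) module \<Rightarrow> ('v \<times> 'u \<Rightarrow>\<^sub>0 int) \<Rightarrow> ('v \<times> 'u \<Rightarrow>\<^sub>0 int) set"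
  where "tensor_class M N t = tensor_rel M N #>\<^bsub>tensor_free M N\<^esub> t"

definition pure_tensor ::
    "('k::field, 'v) module \<Rightarrow> ('k, 'u) module \<Rightarrow> 'v \<Rightarrow> 'u \<Rightarrow> ('v \<times> 'u \<Rightarrow>\<^sub>0 int) set"
  where "pure_tensor M N x y = tensor_class M N (frag_of (x, y))"

text \<open>\<open>tensor_map M' N' f g\<close> is the map induced by \<open>x \<otimes> y \<mapsto> f x \<otimes> g y\<close>, with values in the
  tensor product of \<open>M'\<close> and \<open>N'\<close>. The union runs over all representatives of a class; it is a
  single class when \<open>f\<close> and \<open>g\<close> are linear.\<close>

definition tensor_map ::
    "('k::field, 'w) module \<Rightarrow> ('k, 'z) module \<Rightarrow> ('v \<Rightarrow> 'w) \<Rightarrow> ('u \<Rightarrow> 'z) \<Rightarrow>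
     ('v \<times> 'u \<Rightarrow>\<^sub>0 int) set \<Rightarrow> ('w \<times> 'z \<Rightarrow>\<^sub>0 int) set"
  where "tensor_map M' N' f g S =
    (\<Union>t\<in>S. tensor_class M' N' (frag_extend (\<lambda>(x, y). frag_of (f x, g y)) t))"

text \<open>Only the module part of the resulting record is meaningful.\<close>

definition tensor ::
    "('k::field, 'v) module \<Rightarrow> ('k, 'u) module \<Rightarrow> ('k, ('v \<times> 'u \<Rightarrow>\<^sub>0 int) set) module"
  where "tensor M N =
    \<lparr>carrier = carrier (tensor_free M N Mod tensor_rel M N),
     monoid.mult = undefined, monoid.one = undefined,
     ring.zero = \<one>\<^bsub>tensor_free M N Mod tensor_rel M N\<^esub>,
     ring.add = (\<otimes>\<^bsub>tensor_free M N Mod tensor_rel M N\<^esub>),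
     module.smult = (\<lambda>c. tensor_map M N (\<lambda>x. c \<odot>\<^bsub>M\<^esub> x) (\<lambda>y. y))\<rparr>"

text \<open>For a commutative algebra \<open>B\<close>, \<open>tensor_mult N B \<mu>\<close> is the \<open>B\<close>-bilinear extension
  \<open>(x \<otimes> b, x' \<otimes> b') \<mapsto> \<mu> x x' \<otimes> b b'\<close> of a bilinear map \<open>\<mu>\<close> with values in \<open>N\<close>.\<close>

definition tensor_mult ::
    "('k::field, 'w) module \<Rightarrow> ('k, 'u) module \<Rightarrow> ('v \<Rightarrow> 'v' \<Rightarrow> 'w) \<Rightarrow>
     ('v \<times> 'u \<Rightarrow>\<^sub>0 int) set \<Rightarrow> ('v' \<times> 'u \<Rightarrow>\<^sub>0 int) set \<Rightarrow> ('w \<times> 'u \<Rightarrow>\<^sub>0 int) set"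
  where "tensor_mult N B \<mu> S T =
    (\<Union>t\<in>S. \<Union>t'\<in>T. tensor_class N B
       (frag_extend (\<lambda>(x, b). frag_extend (\<lambda>(x', b'). frag_of (\<mu> x x', b \<otimes>\<^bsub>B\<^esub> b')) t') t))"


section \<open>Set-valued functors on commutative algebras\<close>

text \<open>Functors are considered on the category of commutative algebras whose carrier is a set of
  elements of an arbitrary type \<^typ>\<open>'u\<close>.\<close>

record ('k, 'u, 'x) set_functor =
  obj :: "('k, 'u) module \<Rightarrow> 'x set"
  arr :: "('k, 'u) module \<Rightarrow> ('k, 'u) module \<Rightarrow> ('u \<Rightarrow> 'u) \<Rightarrow> 'x \<Rightarrow> 'x"

definition is_functor :: "('k::field, 'u, 'x) set_functor \<Rightarrow> bool"
  where "is_functor F \<longleftrightarrow>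
    (\<forall>B. comm_alg B \<longrightarrow> (\<forall>x\<in>obj F B. arr F B B (alg_id B) x = x)) \<and>
    (\<forall>B C g. comm_alg B \<and> comm_alg C \<and> g \<in> alg_hom B C \<longrightarrow>
       arr F B C g \<in> obj F B \<rightarrow> obj F C) \<and>
    (\<forall>B C D g h. comm_alg B \<and> comm_alg C \<and> comm_alg D \<and> g \<in> alg_hom B C \<and> h \<in> alg_hom C D \<longrightarrow>
       (\<forall>x\<in>obj F B. arr F B D (compose (carrier B) h g) x = arr F C D h (arr F B C g x)))"

definition natural_trans ::
    "('k::field, 'u, 'x) set_functor \<Rightarrow> ('k, 'u, 'y) set_functor \<Rightarrow>
     (('k, 'u) module \<Rightarrow> 'x \<Rightarrow> 'y) \<Rightarrow> bool"
  where "natural_trans F G \<theta> \<longleftrightarrow> is_functor F \<and> is_functor G \<and>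
    (\<forall>B. comm_alg B \<longrightarrow> \<theta> B \<in> obj F B \<rightarrow> obj G B) \<and>
    (\<forall>B C g. comm_alg B \<and> comm_alg C \<and> g \<in> alg_hom B C \<longrightarrow>
       (\<forall>x\<in>obj F B. \<theta> C (arr F B C g x) = arr G B C g (\<theta> B x)))"

definition natural_iso ::
    "('k::field, 'u, 'x) set_functor \<Rightarrow> ('k, 'u, 'y) set_functor \<Rightarrow>
     (('k, 'u) module \<Rightarrow> 'x \<Rightarrow> 'y) \<Rightarrow> bool"
  where "natural_iso F G \<theta> \<longleftrightarrow> natural_trans F G \<theta> \<and>
    (\<forall>B. comm_alg B \<longrightarrow> bij_betw (\<theta> B) (obj F B) (obj G B))"

text \<open>Affine schemes over the ground field are given by their functors of points.\<close>

definition Spec :: "('k::field, 'a) module \<Rightarrow> ('k, 'u, 'a \<Rightarrow> 'u) set_functor"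
  where "Spec A =
    \<lparr>obj = (\<lambda>B. alg_hom A B),
     arr = (\<lambda>B C g p. compose (carrier A) g p)\<rparr>"

definition preimage_functor ::
    "('k::field, 'u, 'x) set_functor \<Rightarrow> (('k, 'u) module \<Rightarrow> 'x \<Rightarrow> 'y) \<Rightarrow>
     ('k, 'u, 'y) set_functor \<Rightarrow> ('k, 'u, 'x) set_functor"
  where "preimage_functor F \<theta> Z =
    \<lparr>obj = (\<lambda>B. {x \<in> obj F B. \<theta> B x \<in> obj Z B}), arr = arr F\<rparr>"

definition origin :: "nat \<Rightarrow> ('k::field, 'u, 'k mpoly \<Rightarrow> 'u) set_functor"
  where "origin n =
    \<lparr>obj = (\<lambda>B. {q \<in> obj (Spec (poly_alg n)) B. \<forall>l\<in>{1..n}. q (poly_var l) = \<zero>\<^bsub>B\<^esub>}),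
     arr = arr (Spec (poly_alg n))\<rparr>"

text \<open>The image of the universal point, i.e. the algebra homomorphism corresponding by Yoneda to a
  morphism \<open>Spec A \<rightarrow> Spec A'\<close>.\<close>

definition comorphism ::
    "('k::field, 'a) module \<Rightarrow> (('k, 'a) module \<Rightarrow> ('a \<Rightarrow> 'a) \<Rightarrow> ('b \<Rightarrow> 'a)) \<Rightarrow> 'b \<Rightarrow> 'a"
  where "comorphism A \<theta> = \<theta> A (alg_id A)"

text \<open>The identification of the \<open>B\<close>-points of affine \<open>n\<close>-space with \<open>M \<otimes> B\<close> given by a basis
  \<open>e\<close> of \<open>M\<close>.\<close>

definition basis_point ::
    "('k::field, 'v) module \<Rightarrow> nat \<Rightarrow> (nat \<Rightarrow> 'v) \<Rightarrow> ('k, 'u) module \<Rightarrow>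
     ('k mpoly \<Rightarrow> 'u) \<Rightarrow> ('v \<times> 'u \<Rightarrow>\<^sub>0 int) set"
  where "basis_point M n e B p =
    (\<Oplus>\<^bsub>tensor M B\<^esub> i\<in>{1..n}. pure_tensor M B (e i) (p (poly_var i)))"


section \<open>Differential graded categories\<close>

text \<open>\<open>cmp P E F G j i \<beta> \<alpha>\<close> is the composite of \<open>\<beta>\<close> of degree \<open>j\<close> from \<open>F\<close> to \<open>G\<close> with \<open>\<alpha>\<close> of
  degree \<open>i\<close> from \<open>E\<close> to \<open>F\<close>.\<close>

record ('o, 'k, 'v) dg_data =
  Ob :: "'o set"
  Hom :: "'o \<Rightarrow> 'o \<Rightarrow> int \<Rightarrow> ('k, 'v) module"
  diff :: "'o \<Rightarrow> 'o \<Rightarrow> int \<Rightarrow> 'v \<Rightarrow> 'v"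
  cmp :: "'o \<Rightarrow> 'o \<Rightarrow> 'o \<Rightarrow> int \<Rightarrow> int \<Rightarrow> 'v \<Rightarrow> 'v \<Rightarrow> 'v"
  ident :: "'o \<Rightarrow> 'v"

locale dg_category =
  fixes P :: "('o, 'k::field, 'v) dg_data"
  assumes Hom_module:
      "\<lbrakk>E \<in> Ob P; F \<in> Ob P\<rbrakk> \<Longrightarrow> module (ground :: 'k ring) (Hom P E F i)"
    and diff_closed:
      "\<lbrakk>E \<in> Ob P; F \<in> Ob P; x \<in> carrier (Hom P E F i)\<rbrakk>
       \<Longrightarrow> diff P E F i x \<in> carrier (Hom P E F (i + 1))"
    and diff_add:
      "\<lbrakk>E \<in> Ob P; F \<in> Ob P; x \<in> carrier (Hom P E F i); y \<in> carrier (Hom P E F i)\<rbrakk>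
       \<Longrightarrow> diff P E F i (x \<oplus>\<^bsub>Hom P E F i\<^esub> y)
           = diff P E F i x \<oplus>\<^bsub>Hom P E F (i + 1)\<^esub> diff P E F i y"
    and diff_smult:
      "\<lbrakk>E \<in> Ob P; F \<in> Ob P; x \<in> carrier (Hom P E F i)\<rbrakk>
       \<Longrightarrow> diff P E F i (c \<odot>\<^bsub>Hom P E F i\<^esub> x) = c \<odot>\<^bsub>Hom P E F (i + 1)\<^esub> diff P E F i x"
    and diff_diff:
      "\<lbrakk>E \<in> Ob P; F \<in> Ob P; x \<in> carrier (Hom P E F i)\<rbrakk>
       \<Longrightarrow> diff P E F (i + 1) (diff P E F i x) = \<zero>\<^bsub>Hom P E F (i + 2)\<^esub>"
    and cmp_closed:
      "\<lbrakk>E \<in> Ob P; F \<in> Ob P; G \<in> Ob P; \<beta> \<in> carrier (Hom P F G j); \<alpha> \<in> carrier (Hom P E F i)\<rbrakk>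
       \<Longrightarrow> cmp P E F G j i \<beta> \<alpha> \<in> carrier (Hom P E G (j + i))"
    and cmp_add_left:
      "\<lbrakk>E \<in> Ob P; F \<in> Ob P; G \<in> Ob P; \<beta> \<in> carrier (Hom P F G j); \<beta>' \<in> carrier (Hom P F G j);
        \<alpha> \<in> carrier (Hom P E F i)\<rbrakk>
       \<Longrightarrow> cmp P E F G j i (\<beta> \<oplus>\<^bsub>Hom P F G j\<^esub> \<beta>') \<alpha>
           = cmp P E F G j i \<beta> \<alpha> \<oplus>\<^bsub>Hom P E G (j + i)\<^esub> cmp P E F G j i \<beta>' \<alpha>"
    and cmp_add_right:
      "\<lbrakk>E \<in> Ob P; F \<in> Ob P; G \<in> Ob P; \<beta> \<in> carrier (Hom P F G j);
        \<alpha> \<in> carrier (Hom P E F i); \<alpha>' \<in> carrier (Hom P E F i)\<rbrakk>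
       \<Longrightarrow> cmp P E F G j i \<beta> (\<alpha> \<oplus>\<^bsub>Hom P E F i\<^esub> \<alpha>')
           = cmp P E F G j i \<beta> \<alpha> \<oplus>\<^bsub>Hom P E G (j + i)\<^esub> cmp P E F G j i \<beta> \<alpha>'"
    and cmp_smult_left:
      "\<lbrakk>E \<in> Ob P; F \<in> Ob P; G \<in> Ob P; \<beta> \<in> carrier (Hom P F G j); \<alpha> \<in> carrier (Hom P E F i)\<rbrakk>
       \<Longrightarrow> cmp P E F G j i (c \<odot>\<^bsub>Hom P F G j\<^esub> \<beta>) \<alpha>
           = c \<odot>\<^bsub>Hom P E G (j + i)\<^esub> cmp P E F G j i \<beta> \<alpha>"
    and cmp_smult_right:
      "\<lbrakk>E \<in> Ob P; F \<in> Ob P; G \<in> Ob P; \<beta> \<in> carrier (Hom P F G j); \<alpha> \<in> carrier (Hom P E F i)\<rbrakk>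
       \<Longrightarrow> cmp P E F G j i \<beta> (c \<odot>\<^bsub>Hom P E F i\<^esub> \<alpha>)
           = c \<odot>\<^bsub>Hom P E G (j + i)\<^esub> cmp P E F G j i \<beta> \<alpha>"
    and cmp_assoc:
      "\<lbrakk>E \<in> Ob P; F \<in> Ob P; G \<in> Ob P; H \<in> Ob P; \<gamma> \<in> carrier (Hom P G H l);
        \<beta> \<in> carrier (Hom P F G j); \<alpha> \<in> carrier (Hom P E F i)\<rbrakk>
       \<Longrightarrow> cmp P E F H (l + j) i (cmp P F G H l j \<gamma> \<beta>) \<alpha>
           = cmp P E G H l (j + i) \<gamma> (cmp P E F G j i \<beta> \<alpha>)"
    and ident_closed:
      "E \<in> Ob P \<Longrightarrow> ident P E \<in> carrier (Hom P E E 0)"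
    and cmp_ident_left:
      "\<lbrakk>E \<in> Ob P; F \<in> Ob P; \<alpha> \<in> carrier (Hom P E F i)\<rbrakk>
       \<Longrightarrow> cmp P E F F 0 i (ident P F) \<alpha> = \<alpha>"
    and cmp_ident_right:
      "\<lbrakk>E \<in> Ob P; F \<in> Ob P; \<alpha> \<in> carrier (Hom P E F i)\<rbrakk>
       \<Longrightarrow> cmp P E E F i 0 \<alpha> (ident P E) = \<alpha>"
    and leibniz:
      "\<lbrakk>E \<in> Ob P; F \<in> Ob P; G \<in> Ob P; \<beta> \<in> carrier (Hom P F G j); \<alpha> \<in> carrier (Hom P E F i)\<rbrakk>
       \<Longrightarrow> diff P E G (j + i) (cmp P E F G j i \<beta> \<alpha>)
           = cmp P E F G (j + 1) i (diff P F G j \<beta>) \<alpha>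
             \<oplus>\<^bsub>Hom P E G (j + i + 1)\<^esub>
             (if even j then cmp P E F G j (i + 1) \<beta> (diff P E F i \<alpha>)
              else \<ominus>\<^bsub>Hom P E G (j + i + 1)\<^esub> cmp P E F G j (i + 1) \<beta> (diff P E F i \<alpha>))"


section \<open>The curvature morphism and the Maurer--Cartan functor\<close>

definition curvature ::
    "('o, 'k::field, 'v) dg_data \<Rightarrow> 'o \<Rightarrow> ('k, 'u) module \<Rightarrow>
     ('v \<times> 'u \<Rightarrow>\<^sub>0 int) set \<Rightarrow> ('v \<times> 'u \<Rightarrow>\<^sub>0 int) set"
  where "curvature P E B \<eta> =
    tensor_map (Hom P E E 2) B (diff P E E 1) (\<lambda>b. b) \<eta>
    \<oplus>\<^bsub>tensor (Hom P E E 2) B\<^esub>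
    tensor_mult (Hom P E E 2) B (cmp P E E E 1 1) \<eta> \<eta>"

definition V_functor ::
    "('o, 'k::field, 'v) dg_data \<Rightarrow> 'o \<Rightarrow> ('k, 'u, ('v \<times> 'u \<Rightarrow>\<^sub>0 int) set) set_functor"
  where "V_functor P E =
    \<lparr>obj = (\<lambda>B. {\<sigma> \<in> carrier (tensor (Hom P E E 1) B).
                  curvature P E B \<sigma> = \<zero>\<^bsub>tensor (Hom P E E 2) B\<^esub>}),
     arr = (\<lambda>B C g. tensor_map (Hom P E E 1) C (\<lambda>x. x) g)\<rparr>"

text \<open>On \<open>B\<close>-points: transport of \<^const>\<open>curvature\<close> along the identifications given by the basis
  \<open>e\<close> of length \<open>r\<close> in degree 1 and the basis \<open>f\<close> of length \<open>s\<close> in degree 2.\<close>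

definition courb ::
    "('o, 'k::field, 'v) dg_data \<Rightarrow> 'o \<Rightarrow> nat \<Rightarrow> (nat \<Rightarrow> 'v) \<Rightarrow> nat \<Rightarrow> (nat \<Rightarrow> 'v) \<Rightarrow>
     ('k, 'u) module \<Rightarrow> ('k mpoly \<Rightarrow> 'u) \<Rightarrow> ('k mpoly \<Rightarrow> 'u)"
  where "courb P E r e s f B p =
    inv_into (obj (Spec (poly_alg s)) B) (basis_point (Hom P E E 2) s f B)
      (curvature P E B (basis_point (Hom P E E 1) r e B p))"

end

theory Submission
  imports Defs
begin

text \<open>
  Everything is a comparison of coordinates. If \<open>e\<^sub>1, \<dots>, e\<^sub>n\<close> is a basis of \<open>M\<close>, then
  every element of \<open>M \<otimes> B\<close> is \<open>\<Sum>\<^sub>i e\<^sub>i \<otimes> b\<^sub>i\<close> for exactly one tuple \<open>b\<close> in \<open>B\<^sup>n\<close>.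
  An algebra homomorphism from the polynomial algebra in \<open>n\<close> variables to \<open>B\<close> is such a tuple as
  well, namely the images of the variables. Both identifications together say that
  \<^const>\<open>basis_point\<close> is a bijection onto \<open>M \<otimes> B\<close> (lemma \<open>basis_point_bij\<close>), and it is natural
  in \<open>B\<close> (lemma \<open>basis_point_natural\<close>).

  The maps \<open>\<phi> \<otimes> g\<close> and \<open>(x \<otimes> b, x' \<otimes> b') \<mapsto> \<mu> x x' \<otimes> b b'\<close> are then given by the structure
  constants of \<open>\<phi>\<close> and \<open>\<mu>\<close> (lemmas \<open>tcoord_tensor_map\<close> and \<open>tcoord_tensor_mult\<close>). Applied to the
  differential and the composition, this shows that the \<open>l\<close>-th coordinate of \<open>d \<sigma> + \<sigma>\<^sup>2\<close>, for \<open>\<sigma>\<close>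
  corresponding to a point \<open>p\<close>, is \<open>p\<close> applied to the polynomial
  \<open>\<Sum>\<^sub>i b\<^sub>i\<^sub>l x\<^sub>i + \<Sum>\<^sub>i\<^sub>j a\<^sub>i\<^sub>j\<^sub>l x\<^sub>i x\<^sub>j\<close> (lemma \<open>tcoord_curvature_point\<close>). So this polynomial is the
  image of \<open>y\<^sub>l\<close> under the comorphism, and \<open>\<sigma>\<close> is a Maurer--Cartan element if and only if \<open>p\<close> kills
  all these polynomials. The latter says on the one hand that \<open>p\<close> lies over the origin, and on the
  other hand that \<open>p\<close> factors, uniquely, through the quotient by the ideal that they generate
  (lemma \<open>quot_universal\<close>).
\<close>

(* Keeps the index sets {1..n} from being rewritten to {Suc 0..n}. *)
declare One_nat_def [simp del]

section \<open>Linear algebra over the ground field\<close>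

lemma ground_simps [simp]:
  "carrier ground = UNIV" "x \<oplus>\<^bsub>ground\<^esub> y = x + y" "x \<otimes>\<^bsub>ground\<^esub> y = x * y"
  "\<zero>\<^bsub>ground\<^esub> = 0" "\<one>\<^bsub>ground\<^esub> = 1"
  by (simp_all add: ring_of_type_algebra_def)

text \<open>The module laws, restated with the operations of the type of scalars in place of those of the
  record \<^const>\<open>ring_of_type_algebra\<close>.\<close>

locale vspace = module ground M for M :: "('k::field, 'v) module"
begin

lemma smult_mem [simp, intro]: "x \<in> carrier M \<Longrightarrow> c \<odot>\<^bsub>M\<^esub> x \<in> carrier M"
  using smult_closed[of c x] by simp

lemma smult_add_left: "x \<in> carrier M \<Longrightarrow> (a + b) \<odot>\<^bsub>M\<^esub> x = a \<odot>\<^bsub>M\<^esub> x \<oplus>\<^bsub>M\<^esub> b \<odot>\<^bsub>M\<^esub> x"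
  using smult_l_distr[of a b x] by simp

lemma smult_add_right:
  "x \<in> carrier M \<Longrightarrow> y \<in> carrier M \<Longrightarrow> a \<odot>\<^bsub>M\<^esub> (x \<oplus>\<^bsub>M\<^esub> y) = a \<odot>\<^bsub>M\<^esub> x \<oplus>\<^bsub>M\<^esub> a \<odot>\<^bsub>M\<^esub> y"
  using smult_r_distr[of a x y] by simp

lemma smult_smult: "x \<in> carrier M \<Longrightarrow> a \<odot>\<^bsub>M\<^esub> (b \<odot>\<^bsub>M\<^esub> x) = (a * b) \<odot>\<^bsub>M\<^esub> x"
  using smult_assoc1[of a b x] by simp

lemma smult_1 [simp]: "x \<in> carrier M \<Longrightarrow> 1 \<odot>\<^bsub>M\<^esub> x = x"
  using smult_one[of x] by simp

lemma smult_0 [simp]: "x \<in> carrier M \<Longrightarrow> 0 \<odot>\<^bsub>M\<^esub> x = \<zero>\<^bsub>M\<^esub>"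
  using smult_l_null[of x] by simp

lemma smult_zero [simp]: "c \<odot>\<^bsub>M\<^esub> \<zero>\<^bsub>M\<^esub> = \<zero>\<^bsub>M\<^esub>"
  using smult_r_null[of c] by simp

lemma smult_sum_left:
  "finite A \<Longrightarrow> x \<in> carrier M \<Longrightarrow> (\<Sum>i\<in>A. c i) \<odot>\<^bsub>M\<^esub> x = (\<Oplus>\<^bsub>M\<^esub>i\<in>A. c i \<odot>\<^bsub>M\<^esub> x)"
  by (induction A rule: finite_induct) (simp_all add: smult_add_left)

lemma smult_finsum_right:
  "finite A \<Longrightarrow> f \<in> A \<rightarrow> carrier M \<Longrightarrow> c \<odot>\<^bsub>M\<^esub> (\<Oplus>\<^bsub>M\<^esub>i\<in>A. f i) = (\<Oplus>\<^bsub>M\<^esub>i\<in>A. c \<odot>\<^bsub>M\<^esub> f i)"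
  using finsum_smult_ldistr[of A c f] by simp

end

definition lin_map :: "('k::field, 'v) module \<Rightarrow> ('k, 'w) module \<Rightarrow> ('v \<Rightarrow> 'w) \<Rightarrow> bool"
  where "lin_map M N f \<longleftrightarrow> f \<in> carrier M \<rightarrow> carrier N \<and>
    (\<forall>x\<in>carrier M. \<forall>y\<in>carrier M. f (x \<oplus>\<^bsub>M\<^esub> y) = f x \<oplus>\<^bsub>N\<^esub> f y) \<and>
    (\<forall>c. \<forall>x\<in>carrier M. f (c \<odot>\<^bsub>M\<^esub> x) = c \<odot>\<^bsub>N\<^esub> f x)"

definition coord :: "('k::field, 'v) module \<Rightarrow> nat \<Rightarrow> (nat \<Rightarrow> 'v) \<Rightarrow> 'v \<Rightarrow> nat \<Rightarrow> 'k"
  where "coord M n e x = (THE c. c \<in> {1..n} \<rightarrow>\<^sub>E UNIV \<and> x = (\<Oplus>\<^bsub>M\<^esub>i\<in>{1..n}. c i \<odot>\<^bsub>M\<^esub> e i))"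

locale based_vspace = vspace M for M :: "('k::field, 'v) module" +
  fixes n :: nat and e :: "nat \<Rightarrow> 'v"
  assumes basis: "is_basis M n e"
begin

lemma basis_mem [simp]: "i \<in> {1..n} \<Longrightarrow> e i \<in> carrier M"
  using basis unfolding is_basis_def by blast

lemma coord_spec:
  assumes "x \<in> carrier M"
  shows "coord M n e x \<in> {1..n} \<rightarrow>\<^sub>E UNIV \<and> x = (\<Oplus>\<^bsub>M\<^esub>i\<in>{1..n}. coord M n e x i \<odot>\<^bsub>M\<^esub> e i)"
proof -
  have "\<exists>!c. c \<in> {1..n} \<rightarrow>\<^sub>E UNIV \<and> x = (\<Oplus>\<^bsub>M\<^esub>i\<in>{1..n}. c i \<odot>\<^bsub>M\<^esub> e i)"
    using basis assms by (simp add: is_basis_def)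
  from theI'[OF this] show ?thesis
    unfolding coord_def .
qed

lemma coord_expand: "x \<in> carrier M \<Longrightarrow> (\<Oplus>\<^bsub>M\<^esub>i\<in>{1..n}. coord M n e x i \<odot>\<^bsub>M\<^esub> e i) = x"
  using coord_spec by metis

lemma coord_lincomb:
  assumes "j \<in> {1..n}"
  shows "coord M n e (\<Oplus>\<^bsub>M\<^esub>i\<in>{1..n}. c i \<odot>\<^bsub>M\<^esub> e i) j = c j"
proof -
  let ?x = "\<Oplus>\<^bsub>M\<^esub>i\<in>{1..n}. c i \<odot>\<^bsub>M\<^esub> e i"
  have x: "?x \<in> carrier M"
    by (rule finsum_closed) auto
  have "?x = (\<Oplus>\<^bsub>M\<^esub>i\<in>{1..n}. restrict c {1..n} i \<odot>\<^bsub>M\<^esub> e i)"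
    by (rule finsum_cong') auto
  moreover have "restrict c {1..n} \<in> {1..n} \<rightarrow>\<^sub>E UNIV"
    by simp
  ultimately have "coord M n e ?x = restrict c {1..n}"
    using coord_spec[OF x] basis x unfolding is_basis_def by blast
  with assms show ?thesis by simp
qed

lemma coord_basis:
  assumes "i \<in> {1..n}" "j \<in> {1..n}"
  shows "coord M n e (e i) j = (if i = j then 1 else 0)"
proof -
  have "(\<Oplus>\<^bsub>M\<^esub>k\<in>{1..n}. (if i = k then 1 else 0) \<odot>\<^bsub>M\<^esub> e k) = (\<Oplus>\<^bsub>M\<^esub>k\<in>{1..n}. if i = k then e k else \<zero>\<^bsub>M\<^esub>)"
    by (rule finsum_cong') auto
  also have "\<dots> = e i"
    using assms by (intro finsum_singleton) auto
  finally show ?thesis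
    using coord_lincomb[OF assms(2), of "\<lambda>k. if i = k then 1 else 0"] by simp
qed

lemma coord_add:
  assumes "x \<in> carrier M" "y \<in> carrier M" "j \<in> {1..n}"
  shows "coord M n e (x \<oplus>\<^bsub>M\<^esub> y) j = coord M n e x j + coord M n e y j"
proof -
  have "x \<oplus>\<^bsub>M\<^esub> y = (\<Oplus>\<^bsub>M\<^esub>i\<in>{1..n}. coord M n e x i \<odot>\<^bsub>M\<^esub> e i) \<oplus>\<^bsub>M\<^esub> (\<Oplus>\<^bsub>M\<^esub>i\<in>{1..n}. coord M n e y i \<odot>\<^bsub>M\<^esub> e i)"
    using assms by (simp add: coord_expand)
  also have "\<dots> = (\<Oplus>\<^bsub>M\<^esub>i\<in>{1..n}. coord M n e x i \<odot>\<^bsub>M\<^esub> e i \<oplus>\<^bsub>M\<^esub> coord M n e y i \<odot>\<^bsub>M\<^esub> e i)"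
    by (rule finsum_addf[symmetric]) auto
  also have "\<dots> = (\<Oplus>\<^bsub>M\<^esub>i\<in>{1..n}. (coord M n e x i + coord M n e y i) \<odot>\<^bsub>M\<^esub> e i)"
    by (rule finsum_cong') (auto simp: smult_add_left)
  finally show ?thesis
    using coord_lincomb[OF assms(3)] by simp
qed

lemma coord_smult:
  assumes "x \<in> carrier M" "j \<in> {1..n}"
  shows "coord M n e (c \<odot>\<^bsub>M\<^esub> x) j = c * coord M n e x j"
proof -
  have "c \<odot>\<^bsub>M\<^esub> x = c \<odot>\<^bsub>M\<^esub> (\<Oplus>\<^bsub>M\<^esub>i\<in>{1..n}. coord M n e x i \<odot>\<^bsub>M\<^esub> e i)"
    using assms by (simp add: coord_expand)
  also have "\<dots> = (\<Oplus>\<^bsub>M\<^esub>i\<in>{1..n}. c \<odot>\<^bsub>M\<^esub> (coord M n e x i \<odot>\<^bsub>M\<^esub> e i))"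
    by (rule smult_finsum_right) auto
  also have "\<dots> = (\<Oplus>\<^bsub>M\<^esub>i\<in>{1..n}. (c * coord M n e x i) \<odot>\<^bsub>M\<^esub> e i)"
    by (rule finsum_cong') (auto simp: smult_smult)
  finally show ?thesis
    using coord_lincomb[OF assms(2)] by simp
qed

lemma coord_finsum:
  assumes "finite A" "f \<in> A \<rightarrow> carrier M" "j \<in> {1..n}"
  shows "coord M n e (\<Oplus>\<^bsub>M\<^esub>i\<in>A. f i) j = (\<Sum>i\<in>A. coord M n e (f i) j)"
  using assms
proof (induction A rule: finite_induct)
  case empty
  have "coord M n e (0 \<odot>\<^bsub>M\<^esub> \<zero>\<^bsub>M\<^esub>) j = 0"
    using coord_smult[OF zero_closed \<open>j \<in> _\<close>, of 0] by (simp del: smult_0 smult_zero)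
  then show ?case by simp
next
  case (insert x F)
  then show ?case
    by (simp add: coord_add Pi_def finsum_closed)
qed

lemma lin_map_expand:
  assumes "abelian_group N" "lin_map M N f" "x \<in> carrier M"
  shows "f x = (\<Oplus>\<^bsub>N\<^esub>i\<in>{1..n}. coord M n e x i \<odot>\<^bsub>N\<^esub> f (e i))"
proof -
  interpret N: abelian_group N by fact
  have f: "f y \<in> carrier N" if "y \<in> carrier M" for y
    using assms(2) that unfolding lin_map_def by auto
  have f_add: "f (y \<oplus>\<^bsub>M\<^esub> z) = f y \<oplus>\<^bsub>N\<^esub> f z" if "y \<in> carrier M" "z \<in> carrier M" for y z
    using assms(2) that unfolding lin_map_def by auto
  have f_smult: "f (c \<odot>\<^bsub>M\<^esub> y) = c \<odot>\<^bsub>N\<^esub> f y" if "y \<in> carrier M" for c y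
    using assms(2) that unfolding lin_map_def by auto
  have f0: "f \<zero>\<^bsub>M\<^esub> = \<zero>\<^bsub>N\<^esub>"
    using f_add[of "\<zero>\<^bsub>M\<^esub>" "\<zero>\<^bsub>M\<^esub>"] f[of "\<zero>\<^bsub>M\<^esub>"] N.add.l_cancel_one by force
  have "f (\<Oplus>\<^bsub>M\<^esub>i\<in>A. g i) = (\<Oplus>\<^bsub>N\<^esub>i\<in>A. f (g i))" if "finite A" "g \<in> A \<rightarrow> carrier M" for A and g :: "nat \<Rightarrow> _"
    using that
  proof (induction A rule: finite_induct)
    case (insert x F)
    then show ?case
      by (simp add: f_add Pi_def finsum_closed f)
  qed (simp add: f0)
  from this[of "{1..n}" "\<lambda>i. coord M n e x i \<odot>\<^bsub>M\<^esub> e i"]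
  have "f x = (\<Oplus>\<^bsub>N\<^esub>i\<in>{1..n}. f (coord M n e x i \<odot>\<^bsub>M\<^esub> e i))"
    using assms by (simp add: coord_expand)
  also have "\<dots> = (\<Oplus>\<^bsub>N\<^esub>i\<in>{1..n}. coord M n e x i \<odot>\<^bsub>N\<^esub> f (e i))"
  proof (rule N.finsum_cong'[OF refl])
    have "c \<odot>\<^bsub>N\<^esub> f (e i) \<in> carrier N" if "i \<in> {1..n}" for c i
      using f[of "c \<odot>\<^bsub>M\<^esub> e i"] f_smult[of "e i" c] that by simp
    then show "(\<lambda>i. coord M n e x i \<odot>\<^bsub>N\<^esub> f (e i)) \<in> {1..n} \<rightarrow> carrier N"
      by blast
  qed (use f_smult in simp)
  finally show ?thesis .
qed

end

section \<open>Commutative algebras\<close>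

locale calg = algebra ground B for B :: "('k::field, 'u) module"
begin

sublocale vspace B ..

lemma smult_mult_left:
  "x \<in> carrier B \<Longrightarrow> y \<in> carrier B \<Longrightarrow> (c \<odot>\<^bsub>B\<^esub> x) \<otimes>\<^bsub>B\<^esub> y = c \<odot>\<^bsub>B\<^esub> (x \<otimes>\<^bsub>B\<^esub> y)"
  using smult_assoc2[of c x y] by simp

lemma smult_mult_right:
  "x \<in> carrier B \<Longrightarrow> y \<in> carrier B \<Longrightarrow> x \<otimes>\<^bsub>B\<^esub> (c \<odot>\<^bsub>B\<^esub> y) = c \<odot>\<^bsub>B\<^esub> (x \<otimes>\<^bsub>B\<^esub> y)"
  using smult_assoc2[of c y x] by (simp add: m_comm)

end

lemma calgI: "comm_alg B \<Longrightarrow> calg B"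
  by (simp add: calg_def)

section \<open>The tensor product with an algebra in coordinates\<close>

locale tensor_pair = M: vspace M + B: calg B
  for M :: "('k::field, 'v) module" and B :: "('k, 'u) module"
begin

sublocale free: comm_group "tensor_free M B"
  unfolding tensor_free_def by (rule abelian_free_Abelian_group)

lemma free_carrier:
  "t \<in> carrier (tensor_free M B) \<longleftrightarrow> Poly_Mapping.keys t \<subseteq> carrier M \<times> carrier B"
  by (simp add: tensor_free_def)

lemma free_simps [simp]:
  "t \<otimes>\<^bsub>tensor_free M B\<^esub> t' = t + t'" "\<one>\<^bsub>tensor_free M B\<^esub> = 0"
  by (simp_all add: tensor_free_def)

lemma free_mem [simp]:
  "frag_of (x, y) \<in> carrier (tensor_free M B) \<longleftrightarrow> x \<in> carrier M \<and> y \<in> carrier B"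
  by (simp add: free_carrier)

lemma free_inv:
  "t \<in> carrier (tensor_free M B) \<Longrightarrow> inv\<^bsub>tensor_free M B\<^esub> t = - t"
  by (simp add: tensor_free_def)

lemma free_diff_mem [simp]:
  assumes "t \<in> carrier (tensor_free M B)" "t' \<in> carrier (tensor_free M B)"
  shows "t - t' \<in> carrier (tensor_free M B)"
  using assms keys_diff[of t t'] by (auto simp: free_carrier)

lemma free_add_mem [simp]:
  assumes "t \<in> carrier (tensor_free M B)" "t' \<in> carrier (tensor_free M B)"
  shows "t + t' \<in> carrier (tensor_free M B)"
  using free.m_closed[OF assms] by simp

lemma tensor_relators:
  "x \<in> carrier M \<Longrightarrow> x' \<in> carrier M \<Longrightarrow> y \<in> carrier B \<Longrightarrow>
    frag_of (x \<oplus>\<^bsub>M\<^esub> x', y) - frag_of (x, y) - frag_of (x', y) \<in> tensor_rel M B"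
  "x \<in> carrier M \<Longrightarrow> y \<in> carrier B \<Longrightarrow> y' \<in> carrier B \<Longrightarrow>
    frag_of (x, y \<oplus>\<^bsub>B\<^esub> y') - frag_of (x, y) - frag_of (x, y') \<in> tensor_rel M B"
  "x \<in> carrier M \<Longrightarrow> y \<in> carrier B \<Longrightarrow>
    frag_of (c \<odot>\<^bsub>M\<^esub> x, y) - frag_of (x, c \<odot>\<^bsub>B\<^esub> y) \<in> tensor_rel M B"
  unfolding tensor_rel_def by (rule generate.incl; blast)+

text \<open>To see that an additive map vanishes on the relations it suffices to check the three kinds of
  relators.\<close>

lemma tensor_rel_least:
  assumes "subgroup H (tensor_free M B)"
    and "\<And>x x' y. x \<in> carrier M \<Longrightarrow> x' \<in> carrier M \<Longrightarrow> y \<in> carrier B \<Longrightarrow>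
      frag_of (x \<oplus>\<^bsub>M\<^esub> x', y) - frag_of (x, y) - frag_of (x', y) \<in> H"
    and "\<And>x y y'. x \<in> carrier M \<Longrightarrow> y \<in> carrier B \<Longrightarrow> y' \<in> carrier B \<Longrightarrow>
      frag_of (x, y \<oplus>\<^bsub>B\<^esub> y') - frag_of (x, y) - frag_of (x, y') \<in> H"
    and "\<And>c x y. x \<in> carrier M \<Longrightarrow> y \<in> carrier B \<Longrightarrow>
      frag_of (c \<odot>\<^bsub>M\<^esub> x, y) - frag_of (x, c \<odot>\<^bsub>B\<^esub> y) \<in> H"
  shows "tensor_rel M B \<subseteq> H"
  unfolding tensor_rel_def
  by (rule free.generate_subgroup_incl[OF _ assms(1)]) (auto intro: assms(2-4))

lemma tensor_rel_subgroup: "subgroup (tensor_rel M B) (tensor_free M B)"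
  unfolding tensor_rel_def
proof (rule free.generate_is_subgroup, safe)
  fix x x' y assume "x \<in> carrier M" "x' \<in> carrier M" "y \<in> carrier B"
  then show "frag_of (x \<oplus>\<^bsub>M\<^esub> x', y) - frag_of (x, y) - frag_of (x', y) \<in> carrier (tensor_free M B)"
    by simp
next
  fix x y y' assume "x \<in> carrier M" "y \<in> carrier B" "y' \<in> carrier B"
  then show "frag_of (x, y \<oplus>\<^bsub>B\<^esub> y') - frag_of (x, y) - frag_of (x, y') \<in> carrier (tensor_free M B)"
    by simp
next
  fix c x y assume "x \<in> carrier M" "y \<in> carrier B"
  then show "frag_of (c \<odot>\<^bsub>M\<^esub> x, y) - frag_of (x, c \<odot>\<^bsub>B\<^esub> y) \<in> carrier (tensor_free M B)"
    by simp
qed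

lemma tensor_rel_normal: "tensor_rel M B \<lhd> tensor_free M B"
  by (rule free.subgroup_imp_normal[OF tensor_rel_subgroup])

sublocale T: abelian_group "tensor M B"
proof (rule comm_group_abelian_groupI)
  interpret Q: comm_group "tensor_free M B Mod tensor_rel M B"
    by (rule free.abelian_FactGroup[OF tensor_rel_subgroup])
  have T: "carrier (add_monoid (tensor M B)) = carrier (tensor_free M B Mod tensor_rel M B)"
    "(\<otimes>\<^bsub>add_monoid (tensor M B)\<^esub>) = (\<otimes>\<^bsub>tensor_free M B Mod tensor_rel M B\<^esub>)"
    "\<one>\<^bsub>add_monoid (tensor M B)\<^esub> = \<one>\<^bsub>tensor_free M B Mod tensor_rel M B\<^esub>"
    by (simp_all add: tensor_def)
  show "comm_group (add_monoid (tensor M B))"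
    by (rule comm_groupI; unfold T)
      (use Q.m_assoc Q.m_comm Q.l_inv_ex in \<open>auto simp del: mult_FactGroup one_FactGroup\<close>)
qed

lemma tensor_class_hom: "tensor_class M B \<in> hom (tensor_free M B) (add_monoid (tensor M B))"
  using normal.r_coset_hom_Mod[OF tensor_rel_normal]
  unfolding tensor_class_def tensor_def hom_def by simp

lemma tensor_class_mem [simp]:
  "t \<in> carrier (tensor_free M B) \<Longrightarrow> tensor_class M B t \<in> carrier (tensor M B)"
  using hom_in_carrier[OF tensor_class_hom, of t] by simp

lemma tensor_classE:
  assumes "S \<in> carrier (tensor M B)"
  obtains t where "t \<in> carrier (tensor_free M B)" "S = tensor_class M B t"
  using assms unfolding tensor_def tensor_class_def FactGroup_def RCOSETS_def by auto

lemma tensor_class_rep: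
  assumes "t \<in> carrier (tensor_free M B)" "t' \<in> tensor_class M B t"
  shows "t' \<in> carrier (tensor_free M B)" "tensor_class M B t' = tensor_class M B t"
  using assms free.r_coset_subset_G[OF subgroup.subset[OF tensor_rel_subgroup] assms(1)]
    free.repr_independence[OF _ assms(1) tensor_rel_subgroup, of t']
  unfolding tensor_class_def by (blast, simp)

lemma tensor_class_self: "t \<in> carrier (tensor_free M B) \<Longrightarrow> t \<in> tensor_class M B t"
  unfolding tensor_class_def by (rule free.rcos_self[OF _ tensor_rel_subgroup])

text \<open>An operation on classes that is given by a union over representatives, as in
  \<^const>\<open>tensor_map\<close> and \<^const>\<open>tensor_mult\<close>, has the expected value as soon as the
  class computed from a representative depends only on the class of that representative.\<close>

lemma union_over_class:
  assumes t: "t \<in> carrier (tensor_free M B)"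
    and F: "\<And>t'. t' \<in> carrier (tensor_free M B) \<Longrightarrow> tensor_class M B t' = tensor_class M B t \<Longrightarrow>
      F t' = F t"
  shows "(\<Union>t'\<in>tensor_class M B t. F t') = F t"
proof -
  have "F t' = F t" if "t' \<in> tensor_class M B t" for t'
    using tensor_class_rep[OF t that] F by blast
  with tensor_class_self[OF t] show ?thesis by blast
qed

lemma pure_mem [simp]:
  "x \<in> carrier M \<Longrightarrow> y \<in> carrier B \<Longrightarrow> pure_tensor M B x y \<in> carrier (tensor M B)"
  unfolding pure_tensor_def by simp

lemma class_add:
  assumes "t \<in> carrier (tensor_free M B)" "t' \<in> carrier (tensor_free M B)"
  shows "tensor_class M B (t + t') = tensor_class M B t \<oplus>\<^bsub>tensor M B\<^esub> tensor_class M B t'"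
  using hom_mult[OF tensor_class_hom assms] by simp

lemma class_eqI:
  assumes "t \<in> carrier (tensor_free M B)" "t' \<in> carrier (tensor_free M B)" "t - t' \<in> tensor_rel M B"
  shows "tensor_class M B t = tensor_class M B t'"
proof -
  have "t \<in> tensor_class M B t'"
    unfolding tensor_class_def r_coset_def using assms by force
  with tensor_class_rep[OF assms(2)] show ?thesis by blast
qed

lemma pure_add_left:
  assumes "x \<in> carrier M" "x' \<in> carrier M" "y \<in> carrier B"
  shows "pure_tensor M B (x \<oplus>\<^bsub>M\<^esub> x') y = pure_tensor M B x y \<oplus>\<^bsub>tensor M B\<^esub> pure_tensor M B x' y"
  unfolding pure_tensor_def
  by (subst class_add[symmetric], use assms in simp, use assms in simp, rule class_eqI)
     (use assms tensor_relators(1)[OF assms] in \<open>simp_all add: diff_diff_eq\<close>)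

lemma pure_add_right:
  assumes "x \<in> carrier M" "y \<in> carrier B" "y' \<in> carrier B"
  shows "pure_tensor M B x (y \<oplus>\<^bsub>B\<^esub> y') = pure_tensor M B x y \<oplus>\<^bsub>tensor M B\<^esub> pure_tensor M B x y'"
  unfolding pure_tensor_def
  by (subst class_add[symmetric], use assms in simp, use assms in simp, rule class_eqI)
     (use assms tensor_relators(2)[OF assms] in \<open>simp_all add: diff_diff_eq\<close>)

lemma pure_smult:
  assumes "x \<in> carrier M" "y \<in> carrier B"
  shows "pure_tensor M B (c \<odot>\<^bsub>M\<^esub> x) y = pure_tensor M B x (c \<odot>\<^bsub>B\<^esub> y)"
  unfolding pure_tensor_def
  by (rule class_eqI) (use assms tensor_relators(3)[OF assms] in auto)

lemma pure_zero_left: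
  assumes "y \<in> carrier B"
  shows "pure_tensor M B \<zero>\<^bsub>M\<^esub> y = \<zero>\<^bsub>tensor M B\<^esub>"
  using pure_add_left[of "\<zero>\<^bsub>M\<^esub>" "\<zero>\<^bsub>M\<^esub>" y] assms
  by (simp add: T.add.r_cancel_one')

lemma pure_finsum_left:
  assumes "finite A" "f \<in> A \<rightarrow> carrier M" "y \<in> carrier B"
  shows "pure_tensor M B (\<Oplus>\<^bsub>M\<^esub>i\<in>A. f i) y = (\<Oplus>\<^bsub>tensor M B\<^esub>i\<in>A. pure_tensor M B (f i) y)"
  using assms
proof (induction A rule: finite_induct)
  case (insert i A)
  then show ?case
    by (simp add: pure_add_left Pi_def M.finsum_closed)
qed (simp add: pure_zero_left)

text \<open>A biadditive balanced \<open>\<phi>\<close> extends additively to the free group on pairs; the three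
  conditions say that the extension kills the relators, so it descends to the quotient.\<close>

lemma tensor_universal:
  fixes \<phi> :: "'v \<Rightarrow> 'u \<Rightarrow> 'w"
  assumes "comm_group G"
    and mem: "\<And>x y. x \<in> carrier M \<Longrightarrow> y \<in> carrier B \<Longrightarrow> \<phi> x y \<in> carrier G"
    and add_left: "\<And>x x' y. x \<in> carrier M \<Longrightarrow> x' \<in> carrier M \<Longrightarrow> y \<in> carrier B \<Longrightarrow>
      \<phi> (x \<oplus>\<^bsub>M\<^esub> x') y = \<phi> x y \<otimes>\<^bsub>G\<^esub> \<phi> x' y"
    and add_right: "\<And>x y y'. x \<in> carrier M \<Longrightarrow> y \<in> carrier B \<Longrightarrow> y' \<in> carrier B \<Longrightarrow>
      \<phi> x (y \<oplus>\<^bsub>B\<^esub> y') = \<phi> x y \<otimes>\<^bsub>G\<^esub> \<phi> x y'"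
    and balanced: "\<And>c x y. x \<in> carrier M \<Longrightarrow> y \<in> carrier B \<Longrightarrow>
      \<phi> (c \<odot>\<^bsub>M\<^esub> x) y = \<phi> x (c \<odot>\<^bsub>B\<^esub> y)"
  obtains h where "h \<in> hom (add_monoid (tensor M B)) G"
    "\<And>x y. x \<in> carrier M \<Longrightarrow> y \<in> carrier B \<Longrightarrow> h (pure_tensor M B x y) = \<phi> x y"
proof -
  interpret G: comm_group G by fact
  have "(\<lambda>(x, y). \<phi> x y) ` (carrier M \<times> carrier B) \<subseteq> carrier G"
    using mem by auto
  from G.free_Abelian_group_universal[OF this] obtain h0
    where "h0 \<in> hom (free_Abelian_group (carrier M \<times> carrier B)) G"
      and "\<And>z. z \<in> carrier M \<times> carrier B \<Longrightarrow> h0 (frag_of z) = (case z of (x, y) \<Rightarrow> \<phi> x y)"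
    by blast
  then have h0: "h0 \<in> hom (tensor_free M B) G"
    and h0_frag: "\<And>x y. x \<in> carrier M \<Longrightarrow> y \<in> carrier B \<Longrightarrow> h0 (frag_of (x, y)) = \<phi> x y"
    by (simp_all add: tensor_free_def)
  interpret h0: group_hom "tensor_free M B" G h0
    by (simp add: group_hom_def group_hom_axioms_def h0)
  have h0_diff: "h0 (t - t') = h0 t \<otimes>\<^bsub>G\<^esub> inv\<^bsub>G\<^esub> h0 t'"
    if t: "t \<in> carrier (tensor_free M B)" "t' \<in> carrier (tensor_free M B)" for t t'
  proof -
    have "h0 (t \<otimes>\<^bsub>tensor_free M B\<^esub> inv\<^bsub>tensor_free M B\<^esub> t') = h0 t \<otimes>\<^bsub>G\<^esub> inv\<^bsub>G\<^esub> h0 t'"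
      using t by (simp only: h0.hom_mult h0.hom_inv free.inv_closed)
    then show ?thesis
      using free_inv[OF t(2)] by simp
  qed
  have G_cancel: "(u \<otimes>\<^bsub>G\<^esub> v) \<otimes>\<^bsub>G\<^esub> inv\<^bsub>G\<^esub> u \<otimes>\<^bsub>G\<^esub> inv\<^bsub>G\<^esub> v = \<one>\<^bsub>G\<^esub>"
    if "u \<in> carrier G" "v \<in> carrier G" for u v
  proof -
    have "(u \<otimes>\<^bsub>G\<^esub> v) \<otimes>\<^bsub>G\<^esub> inv\<^bsub>G\<^esub> u = v"
      using that by (metis G.inv_closed G.inv_solve_right' G.m_closed G.m_comm)
    with that show ?thesis by simp
  qed
  have "tensor_rel M B \<subseteq> kernel (tensor_free M B) G h0"
  proof (rule tensor_rel_least[OF h0.subgroup_kernel])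
    fix x x' y assume *: "x \<in> carrier M" "x' \<in> carrier M" "y \<in> carrier B"
    then have "h0 (frag_of (x \<oplus>\<^bsub>M\<^esub> x', y) - frag_of (x, y) - frag_of (x', y)) = \<one>\<^bsub>G\<^esub>"
      by (simp add: h0_diff free_diff_mem free_mem h0_frag add_left mem G_cancel)
    with * show "frag_of (x \<oplus>\<^bsub>M\<^esub> x', y) - frag_of (x, y) - frag_of (x', y) \<in> kernel (tensor_free M B) G h0"
      unfolding kernel_def by (simp add: free_diff_mem free_mem)
  next
    fix x y y' assume *: "x \<in> carrier M" "y \<in> carrier B" "y' \<in> carrier B"
    then have "h0 (frag_of (x, y \<oplus>\<^bsub>B\<^esub> y') - frag_of (x, y) - frag_of (x, y')) = \<one>\<^bsub>G\<^esub>"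
      by (simp add: h0_diff free_diff_mem free_mem h0_frag add_right mem G_cancel)
    with * show "frag_of (x, y \<oplus>\<^bsub>B\<^esub> y') - frag_of (x, y) - frag_of (x, y') \<in> kernel (tensor_free M B) G h0"
      unfolding kernel_def by (simp add: free_diff_mem free_mem)
  next
    fix c x y assume *: "x \<in> carrier M" "y \<in> carrier B"
    then have "h0 (frag_of (c \<odot>\<^bsub>M\<^esub> x, y) - frag_of (x, c \<odot>\<^bsub>B\<^esub> y)) = \<one>\<^bsub>G\<^esub>"
      by (simp add: h0_diff free_mem h0_frag balanced mem)
    with * show "frag_of (c \<odot>\<^bsub>M\<^esub> x, y) - frag_of (x, c \<odot>\<^bsub>B\<^esub> y) \<in> kernel (tensor_free M B) G h0"
      unfolding kernel_def by (simp add: free_diff_mem free_mem)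
  qed
  from h0.FactGroup_universal_kernel[OF tensor_rel_normal this] obtain h
    where h: "h \<in> hom (tensor_free M B Mod tensor_rel M B) G"
      and h_class: "\<And>t. t \<in> carrier (tensor_free M B) \<Longrightarrow> h (tensor_class M B t) = h0 t"
    unfolding tensor_class_def by blast
  show ?thesis
  proof
    show "h \<in> hom (add_monoid (tensor M B)) G"
      using h by (simp add: tensor_def hom_def)
    show "h (pure_tensor M B x y) = \<phi> x y" if "x \<in> carrier M" "y \<in> carrier B" for x y
      using that h_class[of "frag_of (x, y)"] h0_frag by (simp add: pure_tensor_def)
  qed
qed

text \<open>Formulas for coordinates of tensors are proved on representatives: two additive maps agree once
  they agree on single pairs.\<close>

lemma free_hom_eq:
  assumes "group G" "h \<in> hom (tensor_free M B) G" "h' \<in> hom (tensor_free M B) G"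
    and "\<And>x y. x \<in> carrier M \<Longrightarrow> y \<in> carrier B \<Longrightarrow> h (frag_of (x, y)) = h' (frag_of (x, y))"
    and t: "t \<in> carrier (tensor_free M B)"
  shows "h t = h' t"
proof -
  interpret h: group_hom "tensor_free M B" G h
    using assms by (simp add: group_hom_def group_hom_axioms_def)
  interpret h': group_hom "tensor_free M B" G h'
    using assms by (simp add: group_hom_def group_hom_axioms_def)
  from t have "Poly_Mapping.keys t \<subseteq> carrier M \<times> carrier B"
    by (simp add: free_carrier)
  then show ?thesis
  proof (induction t rule: free_Abelian_group_induct[consumes 1, case_names zero diff frag])
    case zero
    then show ?case using h.hom_one h'.hom_one by simp
  next
    case (diff x y)
    have "h (x \<otimes>\<^bsub>tensor_free M B\<^esub> inv\<^bsub>tensor_free M B\<^esub> y) = h' (x \<otimes>\<^bsub>tensor_free M B\<^esub> inv\<^bsub>tensor_free M B\<^esub> y)"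
      using diff by (simp only: h.hom_mult h.hom_inv h'.hom_mult h'.hom_inv free_carrier[symmetric] free.inv_closed)
    then show ?case
      using diff by (simp add: free_inv free_carrier)
  next
    case (frag a)
    then show ?case using assms(4) by auto
  qed
qed

end

text \<open>The \<open>i\<close>-th coordinate \<open>M \<otimes> B \<rightarrow> B\<close>, characterised by
  \<open>x \<otimes> y \<mapsto> x\<^sub>i y\<close> (it exists by the universal property).\<close>

definition tcoord ::
    "('k::field, 'v) module \<Rightarrow> nat \<Rightarrow> (nat \<Rightarrow> 'v) \<Rightarrow> ('k, 'u) module \<Rightarrow> nat \<Rightarrow>
     ('v \<times> 'u \<Rightarrow>\<^sub>0 int) set \<Rightarrow> 'u"
  where "tcoord M n e B i = (SOME h. h \<in> hom (add_monoid (tensor M B)) (add_monoid B) \<and>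
    (\<forall>x\<in>carrier M. \<forall>y\<in>carrier B. h (pure_tensor M B x y) = coord M n e x i \<odot>\<^bsub>B\<^esub> y))"

locale based_tensor = based_vspace M n e + tensor_pair M B
  for M :: "('k::field, 'v) module" and n e and B :: "('k, 'u) module"
begin

lemma tcoord_spec:
  assumes "i \<in> {1..n}"
  shows "tcoord M n e B i \<in> hom (add_monoid (tensor M B)) (add_monoid B) \<and>
    (\<forall>x\<in>carrier M. \<forall>y\<in>carrier B. tcoord M n e B i (pure_tensor M B x y) = coord M n e x i \<odot>\<^bsub>B\<^esub> y)"
proof -
  have "comm_group (add_monoid B)"
    by (rule B.a_comm_group)
  from tensor_universal[OF this, of "\<lambda>x y. coord M n e x i \<odot>\<^bsub>B\<^esub> y"] assms
  have "\<exists>h. h \<in> hom (add_monoid (tensor M B)) (add_monoid B) \<and>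
    (\<forall>x\<in>carrier M. \<forall>y\<in>carrier B. h (pure_tensor M B x y) = coord M n e x i \<odot>\<^bsub>B\<^esub> y)"
    by (simp add: coord_add coord_smult B.smult_add_left B.smult_add_right B.smult_smult mult.commute) metis
  from someI_ex[OF this] show ?thesis
    unfolding tcoord_def .
qed

lemma tcoord_hom: "i \<in> {1..n} \<Longrightarrow> tcoord M n e B i \<in> hom (add_monoid (tensor M B)) (add_monoid B)"
  using tcoord_spec by blast

lemma tcoord_pure:
  "i \<in> {1..n} \<Longrightarrow> x \<in> carrier M \<Longrightarrow> y \<in> carrier B \<Longrightarrow>
    tcoord M n e B i (pure_tensor M B x y) = coord M n e x i \<odot>\<^bsub>B\<^esub> y"
  using tcoord_spec by blast

lemma tcoord_mem [simp]:
  "i \<in> {1..n} \<Longrightarrow> S \<in> carrier (tensor M B) \<Longrightarrow> tcoord M n e B i S \<in> carrier B"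
  using hom_in_carrier[OF tcoord_hom] by fastforce

lemma tcoord_add:
  "i \<in> {1..n} \<Longrightarrow> S \<in> carrier (tensor M B) \<Longrightarrow> S' \<in> carrier (tensor M B) \<Longrightarrow>
    tcoord M n e B i (S \<oplus>\<^bsub>tensor M B\<^esub> S') = tcoord M n e B i S \<oplus>\<^bsub>B\<^esub> tcoord M n e B i S'"
  using hom_mult[OF tcoord_hom, of i S S'] by simp

lemma tcoord_zero [simp]: "i \<in> {1..n} \<Longrightarrow> tcoord M n e B i \<zero>\<^bsub>tensor M B\<^esub> = \<zero>\<^bsub>B\<^esub>"
  using hom_one[OF tcoord_hom T.a_group B.a_group] by simp

lemma tcoord_finsum:
  assumes "finite A" "f \<in> A \<rightarrow> carrier (tensor M B)" "i \<in> {1..n}"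
  shows "tcoord M n e B i (\<Oplus>\<^bsub>tensor M B\<^esub>j\<in>A. f j) = (\<Oplus>\<^bsub>B\<^esub>j\<in>A. tcoord M n e B i (f j))"
  using assms
proof (induction A rule: finite_induct)
  case (insert j A)
  then show ?case
    by (simp add: tcoord_add Pi_def T.finsum_closed)
qed simp

text \<open>Since \<open>e\<close> spans \<open>M\<close>, every tensor has the form \<open>\<Sum>\<^sub>i e\<^sub>i \<otimes> b\<^sub>i\<close>, and the
  \<open>b\<^sub>i\<close> are its coordinates.\<close>

lemma tensor_expand:
  assumes "S \<in> carrier (tensor M B)"
  shows "S = (\<Oplus>\<^bsub>tensor M B\<^esub>i\<in>{1..n}. pure_tensor M B (e i) (tcoord M n e B i S))"
proof -
  obtain t where t: "t \<in> carrier (tensor_free M B)" and S: "S = tensor_class M B t"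
    using tensor_classE[OF assms] .
  let ?h = "\<lambda>t. \<Oplus>\<^bsub>tensor M B\<^esub>i\<in>{1..n}. pure_tensor M B (e i) (tcoord M n e B i (tensor_class M B t))"
  have "tensor_class M B t = ?h t"
  proof (rule free_hom_eq[OF T.a_group tensor_class_hom _ _ t])
    \<comment> \<open>Both sides are additive in the representative, so only \<open>t = (x, y)\<close> remains, where
      \<open>x \<otimes> y = \<Sum>\<^sub>i x\<^sub>i e\<^sub>i \<otimes> y = \<Sum>\<^sub>i e\<^sub>i \<otimes> x\<^sub>i y\<close>.\<close>
    show "?h \<in> hom (tensor_free M B) (add_monoid (tensor M B))"
    proof (rule homI)
      fix t t' assume t: "t \<in> carrier (tensor_free M B)" "t' \<in> carrier (tensor_free M B)"
      have "?h (t + t') = (\<Oplus>\<^bsub>tensor M B\<^esub>i\<in>{1..n}.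
          pure_tensor M B (e i) (tcoord M n e B i (tensor_class M B t)) \<oplus>\<^bsub>tensor M B\<^esub>
          pure_tensor M B (e i) (tcoord M n e B i (tensor_class M B t')))"
        using t by (intro T.finsum_cong')
          (auto simp: class_add tcoord_add pure_add_right)
      also have "\<dots> = ?h t \<oplus>\<^bsub>tensor M B\<^esub> ?h t'"
        using t by (intro T.finsum_addf) (auto)
      finally show "?h (t \<otimes>\<^bsub>tensor_free M B\<^esub> t') = ?h t \<otimes>\<^bsub>add_monoid (tensor M B)\<^esub> ?h t'"
        by simp
    qed (auto intro!: T.finsum_closed)
    fix x y assume xy: "x \<in> carrier M" "y \<in> carrier B"
    have "tensor_class M B (frag_of (x, y)) = pure_tensor M B (\<Oplus>\<^bsub>M\<^esub>i\<in>{1..n}. coord M n e x i \<odot>\<^bsub>M\<^esub> e i) y"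
      using xy by (simp only: coord_expand pure_tensor_def)
    also have "\<dots> = (\<Oplus>\<^bsub>tensor M B\<^esub>i\<in>{1..n}. pure_tensor M B (coord M n e x i \<odot>\<^bsub>M\<^esub> e i) y)"
      using xy by (intro pure_finsum_left) auto
    also have "\<dots> = ?h (frag_of (x, y))"
      using xy by (intro T.finsum_cong')
        (auto simp: pure_smult tcoord_pure pure_tensor_def[symmetric])
    finally show "tensor_class M B (frag_of (x, y)) = ?h (frag_of (x, y))" .
  qed
  with S show ?thesis by simp
qed

lemma tensor_eqI:
  assumes "S \<in> carrier (tensor M B)" "S' \<in> carrier (tensor M B)"
    and "\<And>i. i \<in> {1..n} \<Longrightarrow> tcoord M n e B i S = tcoord M n e B i S'"
  shows "S = S'"
proof -
  have "(\<Oplus>\<^bsub>tensor M B\<^esub>i\<in>{1..n}. pure_tensor M B (e i) (tcoord M n e B i S)) =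
        (\<Oplus>\<^bsub>tensor M B\<^esub>i\<in>{1..n}. pure_tensor M B (e i) (tcoord M n e B i S'))"
    using assms by (intro T.finsum_cong') auto
  then show ?thesis
    unfolding tensor_expand[OF assms(1), symmetric] tensor_expand[OF assms(2), symmetric] .
qed

lemma tcoord_basis_finsum:
  assumes "y \<in> {1..n} \<rightarrow> carrier B" "j \<in> {1..n}"
  shows "tcoord M n e B j (\<Oplus>\<^bsub>tensor M B\<^esub>i\<in>{1..n}. pure_tensor M B (e i) (y i)) = y j"
proof -
  have y: "y i \<in> carrier B" if "i \<in> {1..n}" for i
    using assms that by blast
  have "tcoord M n e B j (\<Oplus>\<^bsub>tensor M B\<^esub>i\<in>{1..n}. pure_tensor M B (e i) (y i)) =
      (\<Oplus>\<^bsub>B\<^esub>i\<in>{1..n}. tcoord M n e B j (pure_tensor M B (e i) (y i)))"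
    using assms y by (intro tcoord_finsum) auto
  also have "\<dots> = (\<Oplus>\<^bsub>B\<^esub>i\<in>{1..n}. if j = i then y i else \<zero>\<^bsub>B\<^esub>)"
    using assms(2) y by (intro B.finsum_cong') (auto simp: tcoord_pure coord_basis)
  also have "\<dots> = y j"
    using assms y by (intro B.finsum_singleton) auto
  finally show ?thesis .
qed

end

lemma lin_map_mem: "lin_map M N f \<Longrightarrow> x \<in> carrier M \<Longrightarrow> f x \<in> carrier N"
  unfolding lin_map_def by blast

lemma lin_map_add:
  "lin_map M N f \<Longrightarrow> x \<in> carrier M \<Longrightarrow> y \<in> carrier M \<Longrightarrow> f (x \<oplus>\<^bsub>M\<^esub> y) = f x \<oplus>\<^bsub>N\<^esub> f y"
  unfolding lin_map_def by blast

lemma lin_map_smult: "lin_map M N f \<Longrightarrow> x \<in> carrier M \<Longrightarrow> f (c \<odot>\<^bsub>M\<^esub> x) = c \<odot>\<^bsub>N\<^esub> f x"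
  unfolding lin_map_def by blast

locale tensor_morphism = src: based_tensor M n e B + tgt: based_tensor N m f C
  for M :: "('k::field, 'v) module" and n e and B :: "('k, 'u) module"
    and N :: "('k, 'w) module" and m f and C :: "('k, 'z) module"
begin

lemma frag_extend_mem:
  assumes "\<And>x y. x \<in> carrier M \<Longrightarrow> y \<in> carrier B \<Longrightarrow> F (x, y) \<in> carrier (tensor_free N C)"
    and "t \<in> carrier (tensor_free M B)"
  shows "frag_extend F t \<in> carrier (tensor_free N C)"
proof -
  have "Poly_Mapping.keys (F z) \<subseteq> carrier N \<times> carrier C" if "z \<in> Poly_Mapping.keys t" for z
  proof -
    from that assms(2) have "z \<in> carrier M \<times> carrier B"
      unfolding src.free_carrier by blast
    then show ?thesis
      using assms(1)[of "fst z" "snd z"] unfolding tgt.free_carrier by auto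
  qed
  then have "(\<Union>z\<in>Poly_Mapping.keys t. Poly_Mapping.keys (F z)) \<subseteq> carrier N \<times> carrier C"
    by blast
  with keys_frag_extend[of F t] show ?thesis
    unfolding tgt.free_carrier by (rule subset_trans)
qed

lemma tcoord_frag_extend_hom:
  assumes F: "\<And>x y. x \<in> carrier M \<Longrightarrow> y \<in> carrier B \<Longrightarrow> F (x, y) \<in> carrier (tensor_free N C)"
    and l: "l \<in> {1..m}"
  shows "(\<lambda>t. tcoord N m f C l (tensor_class N C (frag_extend F t))) \<in> hom (tensor_free M B) (add_monoid C)"
proof (rule homI)
  fix t t' assume "t \<in> carrier (tensor_free M B)" "t' \<in> carrier (tensor_free M B)"
  then show "tcoord N m f C l (tensor_class N C (frag_extend F (t \<otimes>\<^bsub>tensor_free M B\<^esub> t')))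
    = tcoord N m f C l (tensor_class N C (frag_extend F t)) \<otimes>\<^bsub>add_monoid C\<^esub>
      tcoord N m f C l (tensor_class N C (frag_extend F t'))"
    using l by (simp add: frag_extend_add tgt.class_add tgt.tcoord_add frag_extend_mem F)
qed (use l in \<open>simp add: frag_extend_mem F\<close>)

text \<open>Both sides are additive in \<open>t\<close>, so that it suffices to compare them on a single pair
  \<open>(x, y)\<close>, where the claim is the matrix formula for the coordinates of \<open>\<phi> x\<close>.\<close>

lemma tcoord_frag_extend_lin:
  assumes \<phi>: "lin_map M N \<phi>" and g: "lin_map B C g"
    and t: "t \<in> carrier (tensor_free M B)" and l: "l \<in> {1..m}"
  shows "tcoord N m f C l (tensor_class N C (frag_extend (\<lambda>(x, y). frag_of (\<phi> x, g y)) t))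
    = (\<Oplus>\<^bsub>C\<^esub>i\<in>{1..n}. coord N m f (\<phi> (e i)) l \<odot>\<^bsub>C\<^esub> g (tcoord M n e B i (tensor_class M B t)))"
    (is "?h t = ?h' t")
proof (rule src.free_hom_eq[OF tgt.B.a_group _ _ _ t])
  show "?h \<in> hom (tensor_free M B) (add_monoid C)"
    by (rule tcoord_frag_extend_hom) (use l in \<open>auto intro: lin_map_mem[OF \<phi>] lin_map_mem[OF g]\<close>)
  show "?h' \<in> hom (tensor_free M B) (add_monoid C)"
  proof (rule homI)
    fix t t' assume t: "t \<in> carrier (tensor_free M B)" "t' \<in> carrier (tensor_free M B)"
    have "?h' (t + t') = (\<Oplus>\<^bsub>C\<^esub>i\<in>{1..n}.
        coord N m f (\<phi> (e i)) l \<odot>\<^bsub>C\<^esub> g (tcoord M n e B i (tensor_class M B t)) \<oplus>\<^bsub>C\<^esub>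
        coord N m f (\<phi> (e i)) l \<odot>\<^bsub>C\<^esub> g (tcoord M n e B i (tensor_class M B t')))"
      using t by (intro tgt.B.finsum_cong')
        (auto simp: src.class_add src.tcoord_add lin_map_add[OF g] lin_map_mem[OF g] tgt.B.smult_add_right)
    also have "\<dots> = ?h' t \<oplus>\<^bsub>C\<^esub> ?h' t'"
      using t by (intro tgt.B.finsum_addf) (auto simp: lin_map_mem[OF g])
    finally show "?h' (t \<otimes>\<^bsub>tensor_free M B\<^esub> t') = ?h' t \<otimes>\<^bsub>add_monoid C\<^esub> ?h' t'"
      by simp
  qed (auto intro!: tgt.B.finsum_closed simp: lin_map_mem[OF g])
next
  fix x y assume xy: "x \<in> carrier M" "y \<in> carrier B"
  have gy: "g y \<in> carrier C"
    using lin_map_mem[OF g] xy by simp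
  have "coord N m f (\<phi> x) l = (\<Sum>i\<in>{1..n}. coord M n e x i * coord N m f (\<phi> (e i)) l)"
    unfolding src.lin_map_expand[OF tgt.abelian_group_axioms \<phi> xy(1)]
    using l by (subst tgt.coord_finsum) (auto simp: lin_map_mem[OF \<phi>] tgt.coord_smult)
  then have "?h (frag_of (x, y)) = (\<Oplus>\<^bsub>C\<^esub>i\<in>{1..n}. (coord M n e x i * coord N m f (\<phi> (e i)) l) \<odot>\<^bsub>C\<^esub> g y)"
    using xy gy l lin_map_mem[OF \<phi>]
    by (simp add: tgt.tcoord_pure[unfolded pure_tensor_def] tgt.B.smult_sum_left)
  also have "\<dots> = ?h' (frag_of (x, y))"
    using xy gy
    by (intro tgt.B.finsum_cong')
      (auto simp: src.tcoord_pure[unfolded pure_tensor_def] lin_map_smult[OF g] tgt.B.smult_smult mult.commute)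
  finally show "?h (frag_of (x, y)) = ?h' (frag_of (x, y))" .
qed

text \<open>In coordinates, \<open>\<phi> \<otimes> g\<close> is the matrix of \<open>\<phi>\<close> applied to the images under \<open>g\<close> of the
  coordinates.\<close>

lemma
  assumes \<phi>: "lin_map M N \<phi>" and g: "lin_map B C g" and S: "S \<in> carrier (tensor M B)"
  shows tensor_map_mem: "tensor_map N C \<phi> g S \<in> carrier (tensor N C)"
    and tcoord_tensor_map: "l \<in> {1..m} \<Longrightarrow> tcoord N m f C l (tensor_map N C \<phi> g S)
      = (\<Oplus>\<^bsub>C\<^esub>i\<in>{1..n}. coord N m f (\<phi> (e i)) l \<odot>\<^bsub>C\<^esub> g (tcoord M n e B i S))"
proof -
  obtain t where t: "t \<in> carrier (tensor_free M B)" and S: "S = tensor_class M B t"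
    using src.tensor_classE[OF S] .
  let ?F = "\<lambda>t. frag_extend (\<lambda>(x, y). frag_of (\<phi> x, g y)) t"
  have F: "?F t' \<in> carrier (tensor_free N C)" if "t' \<in> carrier (tensor_free M B)" for t'
    using that by (rule frag_extend_mem[rotated]) (auto intro: lin_map_mem[OF \<phi>] lin_map_mem[OF g])
  have "tensor_map N C \<phi> g S = tensor_class N C (?F t)"
    unfolding tensor_map_def S
  proof (rule src.union_over_class[OF t])
    fix t' assume "t' \<in> carrier (tensor_free M B)" "tensor_class M B t' = tensor_class M B t"
    with t show "tensor_class N C (?F t') = tensor_class N C (?F t)"
      by (intro tgt.tensor_eqI) (auto simp: F tcoord_frag_extend_lin[OF \<phi> g])
  qed
  with t S F tcoord_frag_extend_lin[OF \<phi> g t]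
  show "tensor_map N C \<phi> g S \<in> carrier (tensor N C)"
    and "l \<in> {1..m} \<Longrightarrow> tcoord N m f C l (tensor_map N C \<phi> g S)
      = (\<Oplus>\<^bsub>C\<^esub>i\<in>{1..n}. coord N m f (\<phi> (e i)) l \<odot>\<^bsub>C\<^esub> g (tcoord M n e B i S))"
    by simp_all
qed

end

context based_tensor
begin

text \<open>The matrix of the identity is the identity matrix, so base change along \<open>g\<close> applies \<open>g\<close> to each
  coordinate.\<close>

lemma tensor_map_id_mem:
  assumes C: "calg C" and "lin_map B C g" and "S \<in> carrier (tensor M B)"
  shows "tensor_map M C (\<lambda>x. x) g S \<in> carrier (tensor M C)"
proof -
  interpret C: calg C by fact
  interpret mor: tensor_morphism M n e B M n e C ..
  show ?thesis
    by (rule mor.tensor_map_mem) (use assms in \<open>auto simp: lin_map_def\<close>)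
qed

lemma tcoord_tensor_map_id:
  assumes C: "calg C" and g: "lin_map B C g" and S: "S \<in> carrier (tensor M B)" and l: "l \<in> {1..n}"
  shows "tcoord M n e C l (tensor_map M C (\<lambda>x. x) g S) = g (tcoord M n e B l S)"
proof -
  interpret C: calg C by fact
  interpret mor: tensor_morphism M n e B M n e C ..
  have mem: "g (tcoord M n e B i S) \<in> carrier C" if "i \<in> {1..n}" for i
    using lin_map_mem[OF g] that S by simp
  have "tcoord M n e C l (tensor_map M C (\<lambda>x. x) g S)
    = (\<Oplus>\<^bsub>C\<^esub>i\<in>{1..n}. coord M n e (e i) l \<odot>\<^bsub>C\<^esub> g (tcoord M n e B i S))"
    by (rule mor.tcoord_tensor_map) (use assms in \<open>auto simp: lin_map_def\<close>)
  also have "\<dots> = (\<Oplus>\<^bsub>C\<^esub>i\<in>{1..n}. if l = i then g (tcoord M n e B i S) else \<zero>\<^bsub>C\<^esub>)"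
    using l mem by (intro C.finsum_cong') (auto simp: coord_basis)
  also have "\<dots> = g (tcoord M n e B l S)"
    using l mem by (intro C.finsum_singleton) auto
  finally show ?thesis .
qed

end

text \<open>A bilinear map \<open>\<mu>\<close> on \<open>M \<times> M'\<close> with values in \<open>N\<close>. Since tensors are determined by their
  coordinates, its \<open>B\<close>-bilinear extension is understood once its coordinates are expressed by
  the structure constants \<open>(\<mu> e\<^sub>i e'\<^sub>j)\<^sub>l\<close>.\<close>

locale tensor_product_map =
  fst: tensor_morphism M n e B N m f B + snd: tensor_morphism M' n' e' B N m f B
  for M :: "('k::field, 'v) module" and n e
    and M' :: "('k, 'v') module" and n' e'
    and N :: "('k, 'w) module" and m f
    and B :: "('k, 'u) module" +
  fixes \<mu> :: "'v \<Rightarrow> 'v' \<Rightarrow> 'w"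
  assumes lin_left: "x' \<in> carrier M' \<Longrightarrow> lin_map M N (\<lambda>x. \<mu> x x')"
    and lin_right: "x \<in> carrier M \<Longrightarrow> lin_map M' N (\<mu> x)"
begin

abbreviation (input) product_rep :: "('v' \<times> 'u \<Rightarrow>\<^sub>0 int) \<Rightarrow> ('v \<times> 'u \<Rightarrow>\<^sub>0 int) \<Rightarrow> ('w \<times> 'u \<Rightarrow>\<^sub>0 int)"
  where "product_rep t' \<equiv>
    frag_extend (\<lambda>(x, b). frag_extend (\<lambda>(x', b'). frag_of (\<mu> x x', b \<otimes>\<^bsub>B\<^esub> b')) t')"

lemma lin_mult: "b \<in> carrier B \<Longrightarrow> lin_map B B (\<lambda>b'. b \<otimes>\<^bsub>B\<^esub> b')"
  unfolding lin_map_def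
  by (auto simp: fst.src.B.r_distr fst.src.B.smult_mult_right)

lemma inner_rep_mem:
  assumes "t' \<in> carrier (tensor_free M' B)" "x \<in> carrier M" "b \<in> carrier B"
  shows "frag_extend (\<lambda>(x', b'). frag_of (\<mu> x x', b \<otimes>\<^bsub>B\<^esub> b')) t' \<in> carrier (tensor_free N B)"
  using assms(1)
  by (rule snd.frag_extend_mem[rotated])
     (use assms lin_map_mem[OF lin_right] in auto)

lemma product_rep_mem:
  assumes "t \<in> carrier (tensor_free M B)" "t' \<in> carrier (tensor_free M' B)"
  shows "product_rep t' t \<in> carrier (tensor_free N B)"
  using assms(1) by (rule fst.frag_extend_mem[rotated]) (use inner_rep_mem[OF assms(2)] in simp)

text \<open>For fixed \<open>t'\<close> both sides are additive in \<open>t\<close>, and for a single pair \<open>(x, b)\<close> the representative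
  is the one of the map \<open>\<mu> x \<otimes> (b \<cdot> _)\<close>, whose coordinates are already known. Hence two
  linear computations replace one bilinear computation.\<close>

lemma tcoord_product_rep:
  assumes t: "t \<in> carrier (tensor_free M B)" and t': "t' \<in> carrier (tensor_free M' B)"
    and l: "l \<in> {1..m}"
  shows "tcoord N m f B l (tensor_class N B (product_rep t' t))
    = (\<Oplus>\<^bsub>B\<^esub>j\<in>{1..n'}. \<Oplus>\<^bsub>B\<^esub>i\<in>{1..n}. coord N m f (\<mu> (e i) (e' j)) l \<odot>\<^bsub>B\<^esub>
        (tcoord M n e B i (tensor_class M B t) \<otimes>\<^bsub>B\<^esub> tcoord M' n' e' B j (tensor_class M' B t')))"
    (is "?h t = ?h' t")
proof -
  define y where "y j = tcoord M' n' e' B j (tensor_class M' B t')" for j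
  define c where "c i j = coord N m f (\<mu> (e i) (e' j)) l" for i j
  have y: "y j \<in> carrier B" if "j \<in> {1..n'}" for j
    using t' that by (simp add: y_def)
  let ?k = "\<lambda>t. \<Oplus>\<^bsub>B\<^esub>j\<in>{1..n'}. \<Oplus>\<^bsub>B\<^esub>i\<in>{1..n}. c i j \<odot>\<^bsub>B\<^esub> (tcoord M n e B i (tensor_class M B t) \<otimes>\<^bsub>B\<^esub> y j)"
  have "?h t = ?k t"
  proof (rule fst.src.free_hom_eq[OF fst.src.B.a_group _ _ _ t])
    show "?h \<in> hom (tensor_free M B) (add_monoid B)"
      by (rule fst.tcoord_frag_extend_hom) (use inner_rep_mem[OF t'] l in auto)
    show "?k \<in> hom (tensor_free M B) (add_monoid B)"
    proof (rule homI)
      fix u v assume uv: "u \<in> carrier (tensor_free M B)" "v \<in> carrier (tensor_free M B)"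
      have "?k (u + v) = (\<Oplus>\<^bsub>B\<^esub>j\<in>{1..n'}. \<Oplus>\<^bsub>B\<^esub>i\<in>{1..n}.
          c i j \<odot>\<^bsub>B\<^esub> (tcoord M n e B i (tensor_class M B u) \<otimes>\<^bsub>B\<^esub> y j) \<oplus>\<^bsub>B\<^esub>
          c i j \<odot>\<^bsub>B\<^esub> (tcoord M n e B i (tensor_class M B v) \<otimes>\<^bsub>B\<^esub> y j))"
        using uv y by (intro fst.src.B.finsum_cong')
          (auto simp: fst.src.class_add fst.src.tcoord_add fst.src.B.l_distr fst.src.B.smult_add_right
            intro!: fst.src.B.finsum_closed)
      also have "\<dots> = (\<Oplus>\<^bsub>B\<^esub>j\<in>{1..n'}.
          (\<Oplus>\<^bsub>B\<^esub>i\<in>{1..n}. c i j \<odot>\<^bsub>B\<^esub> (tcoord M n e B i (tensor_class M B u) \<otimes>\<^bsub>B\<^esub> y j)) \<oplus>\<^bsub>B\<^esub>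
          (\<Oplus>\<^bsub>B\<^esub>i\<in>{1..n}. c i j \<odot>\<^bsub>B\<^esub> (tcoord M n e B i (tensor_class M B v) \<otimes>\<^bsub>B\<^esub> y j)))"
        using uv y by (intro fst.src.B.finsum_cong' fst.src.B.finsum_addf)
          (auto intro!: fst.src.B.finsum_closed fst.src.B.a_closed)
      also have "\<dots> = ?k u \<oplus>\<^bsub>B\<^esub> ?k v"
        using uv y by (intro fst.src.B.finsum_addf) (auto intro!: fst.src.B.finsum_closed)
      finally show "?k (u \<otimes>\<^bsub>tensor_free M B\<^esub> v) = ?k u \<otimes>\<^bsub>add_monoid B\<^esub> ?k v"
        by simp
    qed (use y in \<open>auto intro!: fst.src.B.finsum_closed\<close>)
  next
    fix x b assume xb: "x \<in> carrier M" "b \<in> carrier B"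
    have coord_mu: "coord N m f (\<mu> x (e' j)) l = (\<Sum>i\<in>{1..n}. coord M n e x i * c i j)"
      if j: "j \<in> {1..n'}" for j
    proof -
      have e'j: "e' j \<in> carrier M'"
        using j by simp
      have "\<mu> x (e' j) = (\<Oplus>\<^bsub>N\<^esub>i\<in>{1..n}. coord M n e x i \<odot>\<^bsub>N\<^esub> \<mu> (e i) (e' j))"
        by (rule fst.src.lin_map_expand[OF fst.tgt.abelian_group_axioms lin_left[OF e'j] xb(1)])
      then show ?thesis
        using l lin_map_mem[OF lin_left[OF e'j]]
        by (subst \<open>\<mu> x (e' j) = _\<close>, subst fst.tgt.coord_finsum)
          (auto simp: fst.tgt.coord_smult c_def)
    qed
    have "?h (frag_of (x, b)) = (\<Oplus>\<^bsub>B\<^esub>j\<in>{1..n'}. coord N m f (\<mu> x (e' j)) l \<odot>\<^bsub>B\<^esub> (b \<otimes>\<^bsub>B\<^esub> y j))"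
      using snd.tcoord_frag_extend_lin[OF lin_right[OF xb(1)] lin_mult[OF xb(2)] t' l]
      by (simp add: y_def)
    also have "\<dots> = ?k (frag_of (x, b))"
    proof (rule fst.src.B.finsum_cong'[OF refl])
      show "(\<lambda>j. \<Oplus>\<^bsub>B\<^esub>i\<in>{1..n}. c i j \<odot>\<^bsub>B\<^esub>
          (tcoord M n e B i (tensor_class M B (frag_of (x, b))) \<otimes>\<^bsub>B\<^esub> y j)) \<in> {1..n'} \<rightarrow> carrier B"
        using xb y by (auto intro!: fst.src.B.finsum_closed)
      fix j assume j: "j \<in> {1..n'}"
      have "coord N m f (\<mu> x (e' j)) l \<odot>\<^bsub>B\<^esub> (b \<otimes>\<^bsub>B\<^esub> y j)
        = (\<Oplus>\<^bsub>B\<^esub>i\<in>{1..n}. (coord M n e x i * c i j) \<odot>\<^bsub>B\<^esub> (b \<otimes>\<^bsub>B\<^esub> y j))"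
        using xb y[OF j] by (simp add: coord_mu[OF j] fst.src.B.smult_sum_left)
      also have "\<dots> = (\<Oplus>\<^bsub>B\<^esub>i\<in>{1..n}. c i j \<odot>\<^bsub>B\<^esub>
          (tcoord M n e B i (tensor_class M B (frag_of (x, b))) \<otimes>\<^bsub>B\<^esub> y j))"
        using xb y[OF j] by (intro fst.src.B.finsum_cong')
          (auto simp: fst.src.tcoord_pure[unfolded pure_tensor_def] fst.src.B.smult_mult_left
            fst.src.B.smult_smult mult.commute)
      finally show "coord N m f (\<mu> x (e' j)) l \<odot>\<^bsub>B\<^esub> (b \<otimes>\<^bsub>B\<^esub> y j)
        = (\<Oplus>\<^bsub>B\<^esub>i\<in>{1..n}. c i j \<odot>\<^bsub>B\<^esub>
          (tcoord M n e B i (tensor_class M B (frag_of (x, b))) \<otimes>\<^bsub>B\<^esub> y j))" .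
    qed
    finally show "?h (frag_of (x, b)) = ?k (frag_of (x, b))" .
  qed
  then show ?thesis
    by (simp add: c_def y_def)
qed

text \<open>The coordinates of a representative of the product depend on \<open>t\<close> and \<open>t'\<close> only through their
  classes; so the double union in the definition of \<^const>\<open>tensor_mult\<close> is a single class.\<close>

lemma
  assumes S: "S \<in> carrier (tensor M B)" and S': "S' \<in> carrier (tensor M' B)"
  shows tensor_mult_mem: "tensor_mult N B \<mu> S S' \<in> carrier (tensor N B)"
    and tcoord_tensor_mult: "l \<in> {1..m} \<Longrightarrow> tcoord N m f B l (tensor_mult N B \<mu> S S')
      = (\<Oplus>\<^bsub>B\<^esub>j\<in>{1..n'}. \<Oplus>\<^bsub>B\<^esub>i\<in>{1..n}. coord N m f (\<mu> (e i) (e' j)) l \<odot>\<^bsub>B\<^esub>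
          (tcoord M n e B i S \<otimes>\<^bsub>B\<^esub> tcoord M' n' e' B j S'))"
proof -
  obtain t where t: "t \<in> carrier (tensor_free M B)" and S: "S = tensor_class M B t"
    using fst.src.tensor_classE[OF S] .
  obtain t' where t': "t' \<in> carrier (tensor_free M' B)" and S': "S' = tensor_class M' B t'"
    using snd.src.tensor_classE[OF S'] .
  have indep: "tensor_class N B (product_rep u' u) = tensor_class N B (product_rep t' t)"
    if "u \<in> carrier (tensor_free M B)" "tensor_class M B u = tensor_class M B t"
      "u' \<in> carrier (tensor_free M' B)" "tensor_class M' B u' = tensor_class M' B t'" for u u'
    using that t t' by (intro fst.tgt.tensor_eqI) (auto simp: product_rep_mem tcoord_product_rep)
  have inner: "(\<Union>u'\<in>S'. tensor_class N B (product_rep u' u)) = tensor_class N B (product_rep t' t)"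
    if u: "u \<in> carrier (tensor_free M B)" "tensor_class M B u = tensor_class M B t" for u
  proof -
    have "(\<Union>u'\<in>S'. tensor_class N B (product_rep u' u)) = tensor_class N B (product_rep t' u)"
      unfolding S'
    proof (rule snd.src.union_over_class[OF t'])
      fix u' assume "u' \<in> carrier (tensor_free M' B)" "tensor_class M' B u' = tensor_class M' B t'"
      from indep[OF u this] indep[OF u t' refl]
      show "tensor_class N B (product_rep u' u) = tensor_class N B (product_rep t' u)"
        by (rule trans[OF _ sym])
    qed
    also have "\<dots> = tensor_class N B (product_rep t' t)"
      by (rule indep[OF u t' refl])
    finally show ?thesis .
  qed
  have "tensor_mult N B \<mu> S S' = (\<Union>u'\<in>S'. tensor_class N B (product_rep u' t))"
    unfolding tensor_mult_def S
  proof (rule fst.src.union_over_class[OF t])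
    fix u assume "u \<in> carrier (tensor_free M B)" "tensor_class M B u = tensor_class M B t"
    from inner[OF this] inner[OF t refl]
    show "(\<Union>u'\<in>S'. tensor_class N B (product_rep u' u)) = (\<Union>u'\<in>S'. tensor_class N B (product_rep u' t))"
      by (rule trans[OF _ sym])
  qed
  also note inner[OF t refl]
  finally have "tensor_mult N B \<mu> S S' = tensor_class N B (product_rep t' t)" .
  with t t' S S' product_rep_mem[OF t t'] tcoord_product_rep[OF t t']
  show "tensor_mult N B \<mu> S S' \<in> carrier (tensor N B)"
    and "l \<in> {1..m} \<Longrightarrow> tcoord N m f B l (tensor_mult N B \<mu> S S')
      = (\<Oplus>\<^bsub>B\<^esub>j\<in>{1..n'}. \<Oplus>\<^bsub>B\<^esub>i\<in>{1..n}. coord N m f (\<mu> (e i) (e' j)) l \<odot>\<^bsub>B\<^esub>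
          (tcoord M n e B i S \<otimes>\<^bsub>B\<^esub> tcoord M' n' e' B j S'))"
    by simp_all
qed

end

section \<open>Homomorphisms and quotients of algebras\<close>

lemma alg_hom_iff:
  "h \<in> alg_hom A B \<longleftrightarrow> h \<in> carrier A \<rightarrow> carrier B \<and> h \<in> extensional (carrier A) \<and>
    (\<forall>x\<in>carrier A. \<forall>y\<in>carrier A. h (x \<oplus>\<^bsub>A\<^esub> y) = h x \<oplus>\<^bsub>B\<^esub> h y) \<and>
    (\<forall>x\<in>carrier A. \<forall>y\<in>carrier A. h (x \<otimes>\<^bsub>A\<^esub> y) = h x \<otimes>\<^bsub>B\<^esub> h y) \<and>
    h \<one>\<^bsub>A\<^esub> = \<one>\<^bsub>B\<^esub> \<and> (\<forall>c. \<forall>x\<in>carrier A. h (c \<odot>\<^bsub>A\<^esub> x) = c \<odot>\<^bsub>B\<^esub> h x)"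
  unfolding alg_hom_def ring_hom_def by auto

lemma alg_homD:
  assumes "h \<in> alg_hom A B"
  shows "\<And>x. x \<in> carrier A \<Longrightarrow> h x \<in> carrier B"
    and "\<And>x y. x \<in> carrier A \<Longrightarrow> y \<in> carrier A \<Longrightarrow> h (x \<oplus>\<^bsub>A\<^esub> y) = h x \<oplus>\<^bsub>B\<^esub> h y"
    and "\<And>x y. x \<in> carrier A \<Longrightarrow> y \<in> carrier A \<Longrightarrow> h (x \<otimes>\<^bsub>A\<^esub> y) = h x \<otimes>\<^bsub>B\<^esub> h y"
    and "h \<one>\<^bsub>A\<^esub> = \<one>\<^bsub>B\<^esub>"
    and "\<And>c x. x \<in> carrier A \<Longrightarrow> h (c \<odot>\<^bsub>A\<^esub> x) = c \<odot>\<^bsub>B\<^esub> h x"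
    and "h \<in> extensional (carrier A)"
  using assms unfolding alg_hom_iff by blast+

lemma alg_hom_eqI:
  assumes "h \<in> alg_hom A B" "h' \<in> alg_hom A B" "\<And>x. x \<in> carrier A \<Longrightarrow> h x = h' x"
  shows "h = h'"
  using assms(3) by (rule extensionalityI[OF alg_homD(6)[OF assms(1)] alg_homD(6)[OF assms(2)]])

lemma alg_hom_lin_map: "h \<in> alg_hom A B \<Longrightarrow> lin_map A B h"
  unfolding alg_hom_iff lin_map_def by blast

context calg
begin

lemma alg_id_hom: "alg_id B \<in> alg_hom B B"
  unfolding alg_hom_iff alg_id_def by auto

lemma alg_hom_compose:
  assumes p: "p \<in> alg_hom B C" and g: "g \<in> alg_hom C D"
  shows "compose (carrier B) g p \<in> alg_hom B D"
  unfolding alg_hom_iff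
  by (auto simp: compose_eq alg_homD[OF p] alg_homD[OF g])

lemma alg_hom_to_zero:
  assumes "calg C" "p \<in> alg_hom B C"
  shows "p \<zero>\<^bsub>B\<^esub> = \<zero>\<^bsub>C\<^esub>"
proof -
  interpret C: calg C by fact
  have "p \<zero>\<^bsub>B\<^esub> = p (0 \<odot>\<^bsub>B\<^esub> \<one>\<^bsub>B\<^esub>)"
    by simp
  also have "\<dots> = \<zero>\<^bsub>C\<^esub>"
    using alg_homD(4,5)[OF assms(2)] by (simp del: smult_0)
  finally show ?thesis .
qed

lemma is_functor_Spec: "is_functor (Spec B :: ('k, 'c, 'u \<Rightarrow> 'c) set_functor)"
  unfolding is_functor_def Spec_def
proof (clarsimp, intro conjI allI impI ballI)
  fix C :: "('k, 'c) module" and p assume "comm_alg C" "p \<in> alg_hom B C"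
  then show "compose (carrier B) (alg_id C) p = p"
    by (intro extensionalityI[OF compose_extensional alg_homD(6)])
      (auto simp: compose_eq alg_id_def alg_homD(1))
next
  fix C D :: "('k, 'c) module" and g assume "comm_alg C \<and> comm_alg D \<and> g \<in> alg_hom C D"
  then show "compose (carrier B) g \<in> alg_hom B C \<rightarrow> alg_hom B D"
    by (blast intro: alg_hom_compose)
next
  fix C D E :: "('k, 'c) module" and g h p assume "comm_alg C \<and> comm_alg D \<and> comm_alg E \<and> g \<in> alg_hom C D \<and> h \<in> alg_hom D E"
    and "p \<in> alg_hom B C"
  then show "compose (carrier B) (compose (carrier C) h g) p = compose (carrier B) h (compose (carrier B) g p)"
    by (intro extensionalityI[OF compose_extensional compose_extensional])
      (auto simp: compose_eq alg_homD(1))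
qed

end

locale calg_ideal = calg A + I: ideal I A for A :: "('k::field, 'a) module" and I
begin

text \<open>Scalars act through the elements \<open>c \<cdot> 1\<close>, so ring ideals are closed under them.\<close>

lemma smult_ideal: "i \<in> I \<Longrightarrow> c \<odot>\<^bsub>A\<^esub> i \<in> I"
proof -
  assume i: "i \<in> I"
  then have "(c \<odot>\<^bsub>A\<^esub> \<one>\<^bsub>A\<^esub>) \<otimes>\<^bsub>A\<^esub> i \<in> I"
    by (intro I.I_l_closed) auto
  with i show ?thesis
    using I.a_Hcarr by (simp add: smult_mult_left)
qed

lemma quot_simps:
  "carrier (quot_alg A I) = carrier (A Quot I)"
  "\<one>\<^bsub>quot_alg A I\<^esub> = \<one>\<^bsub>A Quot I\<^esub>" "\<zero>\<^bsub>quot_alg A I\<^esub> = \<zero>\<^bsub>A Quot I\<^esub>"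
  "x \<otimes>\<^bsub>quot_alg A I\<^esub> y = x \<otimes>\<^bsub>A Quot I\<^esub> y" "x \<oplus>\<^bsub>quot_alg A I\<^esub> y = x \<oplus>\<^bsub>A Quot I\<^esub> y"
  unfolding quot_alg_def by (simp_all add: ring.defs)

text \<open>Scalar multiplication on the quotient is a union over all representatives of a coset; all of
  them give the same coset.\<close>

lemma smult_coset:
  assumes x: "x \<in> carrier A"
  shows "c \<odot>\<^bsub>quot_alg A I\<^esub> (I +>\<^bsub>A\<^esub> x) = I +>\<^bsub>A\<^esub> (c \<odot>\<^bsub>A\<^esub> x)"
proof -
  have "I +>\<^bsub>A\<^esub> (c \<odot>\<^bsub>A\<^esub> y) = I +>\<^bsub>A\<^esub> (c \<odot>\<^bsub>A\<^esub> x)" if y: "y \<in> I +>\<^bsub>A\<^esub> x" for y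
  proof -
    obtain i where i: "i \<in> I" and y: "y = i \<oplus>\<^bsub>A\<^esub> x"
      using y unfolding a_r_coset_def' by auto
    then have "c \<odot>\<^bsub>A\<^esub> y = c \<odot>\<^bsub>A\<^esub> i \<oplus>\<^bsub>A\<^esub> c \<odot>\<^bsub>A\<^esub> x"
      using x I.a_Hcarr by (simp add: smult_add_right)
    then have "c \<odot>\<^bsub>A\<^esub> y \<in> I +>\<^bsub>A\<^esub> (c \<odot>\<^bsub>A\<^esub> x)"
      using smult_ideal[OF i, of c] unfolding a_r_coset_def' by auto
    then show ?thesis
      using I.a_repr_independence'[of "c \<odot>\<^bsub>A\<^esub> y" "c \<odot>\<^bsub>A\<^esub> x"] x by simp
  qed
  with I.a_rcos_self[OF x] have "(\<Union>y\<in>I +>\<^bsub>A\<^esub> x. I +>\<^bsub>A\<^esub> (c \<odot>\<^bsub>A\<^esub> y)) = I +>\<^bsub>A\<^esub> (c \<odot>\<^bsub>A\<^esub> x)"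
    by (intro UN_constant_eq ballI)
  then show ?thesis
    unfolding quot_alg_def by (simp add: ring.defs module.defs)
qed

lemma quot_one: "\<one>\<^bsub>quot_alg A I\<^esub> = I +>\<^bsub>A\<^esub> \<one>\<^bsub>A\<^esub>"
  and quot_zero: "\<zero>\<^bsub>quot_alg A I\<^esub> = I"
  by (simp_all add: quot_simps FactRing_def)

lemma quot_carrierE:
  assumes "S \<in> carrier (quot_alg A I)"
  obtains x where "x \<in> carrier A" "S = I +>\<^bsub>A\<^esub> x"
  using assms by (auto simp: quot_simps FactRing_def A_RCOSETS_def')

lemma coset_mem: "x \<in> carrier A \<Longrightarrow> I +>\<^bsub>A\<^esub> x \<in> carrier (quot_alg A I)"
  by (auto simp: quot_simps FactRing_def A_RCOSETS_def')

lemma coset_ops: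
  assumes "x \<in> carrier A" "y \<in> carrier A"
  shows "(I +>\<^bsub>A\<^esub> x) \<oplus>\<^bsub>quot_alg A I\<^esub> (I +>\<^bsub>A\<^esub> y) = I +>\<^bsub>A\<^esub> (x \<oplus>\<^bsub>A\<^esub> y)"
    and "(I +>\<^bsub>A\<^esub> x) \<otimes>\<^bsub>quot_alg A I\<^esub> (I +>\<^bsub>A\<^esub> y) = I +>\<^bsub>A\<^esub> (x \<otimes>\<^bsub>A\<^esub> y)"
  using assms I.rcos_ring_hom by (simp_all add: quot_simps ring_hom_def)

sublocale quot: calg "quot_alg A I"
proof -
  interpret Q: cring "A Quot I"
    by (rule I.quotient_is_cring) unfold_locales
  have "cring (quot_alg A I)"
  proof (rule cringI)
    show "abelian_group (quot_alg A I)"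
      by (rule abelian_groupI; unfold quot_simps)
        (use Q.a_assoc Q.a_comm Q.add.l_inv_ex in auto)
    show "comm_monoid (quot_alg A I)"
      by (rule comm_monoidI; unfold quot_simps)
        (use Q.m_assoc Q.m_comm in auto)
  qed (simp add: quot_simps Q.l_distr)
  then have "comm_alg (quot_alg A I)"
    by (intro algebraI R.is_cring)
      (auto elim!: quot_carrierE simp: smult_coset coset_ops coset_mem smult_add_left
        smult_add_right smult_smult smult_mult_left)
  then show "calg (quot_alg A I)"
    by (simp add: calg_def)
qed

lemma proj_hom: "(\<lambda>x\<in>carrier A. I +>\<^bsub>A\<^esub> x) \<in> alg_hom A (quot_alg A I)"
  unfolding alg_hom_iff
  by (auto simp: coset_mem coset_ops smult_coset quot_one)

lemma compose_proj:
  "compose (carrier A) \<phi> (\<lambda>x\<in>carrier A. I +>\<^bsub>A\<^esub> x) = compose (carrier A) \<phi> (\<lambda>x. I +>\<^bsub>A\<^esub> x)"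
  by (auto simp: compose_def)

lemma compose_proj_hom:
  assumes "\<phi> \<in> alg_hom (quot_alg A I) C"
  shows "compose (carrier A) \<phi> (\<lambda>x. I +>\<^bsub>A\<^esub> x) \<in> alg_hom A C"
  using alg_hom_compose[OF proj_hom assms] by (simp add: compose_proj)

text \<open>The universal property of the quotient: for a homomorphism \<open>p\<close> vanishing on \<open>I\<close>, the value on a
  coset is the value of \<open>p\<close> on any of its elements.\<close>

lemma quot_universal:
  assumes "calg C"
  shows "bij_betw (\<lambda>\<phi>. compose (carrier A) \<phi> (\<lambda>x. I +>\<^bsub>A\<^esub> x)) (alg_hom (quot_alg A I) C)
    {p \<in> alg_hom A C. \<forall>x\<in>I. p x = \<zero>\<^bsub>C\<^esub>}"
  (is "bij_betw ?F ?X ?Y")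
proof -
  interpret C: calg C by fact
  have "inj_on ?F ?X"
  proof (rule inj_onI)
    fix \<phi> \<psi> assume h: "\<phi> \<in> ?X" "\<psi> \<in> ?X" and eq: "?F \<phi> = ?F \<psi>"
    show "\<phi> = \<psi>"
    proof (rule alg_hom_eqI[OF h])
      fix S assume "S \<in> carrier (quot_alg A I)"
      then obtain x where "x \<in> carrier A" "S = I +>\<^bsub>A\<^esub> x"
        by (rule quot_carrierE)
      with fun_cong[OF eq, of x] show "\<phi> S = \<psi> S"
        by (simp add: compose_eq)
    qed
  qed
  moreover have "?F \<phi> \<in> ?Y" if \<phi>: "\<phi> \<in> ?X" for \<phi>
  proof -
    have "?F \<phi> x = \<zero>\<^bsub>C\<^esub>" if "x \<in> I" for x
    proof -
      have "I +>\<^bsub>A\<^esub> x = \<zero>\<^bsub>quot_alg A I\<^esub>"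
        using that
        by (simp add: quot_zero I.a_rcos_const)
      with that show ?thesis
        using quot.alg_hom_to_zero[OF C.calg_axioms \<phi>] I.a_Hcarr by (simp add: compose_eq)
    qed
    with compose_proj_hom[OF \<phi>] show ?thesis by blast
  qed
  moreover have "p \<in> ?F ` ?X" if "p \<in> ?Y" for p
  proof -
    from that have p: "p \<in> alg_hom A C" and pI: "\<And>x. x \<in> I \<Longrightarrow> p x = \<zero>\<^bsub>C\<^esub>" by auto
    define \<phi> where "\<phi> = (\<lambda>S\<in>carrier (quot_alg A I). p (SOME x. x \<in> S))"
    have \<phi>: "\<phi> (I +>\<^bsub>A\<^esub> x) = p x" if x: "x \<in> carrier A" for x
    proof -
      have "(SOME y. y \<in> I +>\<^bsub>A\<^esub> x) \<in> I +>\<^bsub>A\<^esub> x"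
        by (rule someI_ex) (use I.a_rcos_self[OF x] in blast)
      then obtain i where "i \<in> I" "(SOME y. y \<in> I +>\<^bsub>A\<^esub> x) = i \<oplus>\<^bsub>A\<^esub> x"
        unfolding a_r_coset_def' by auto
      then show ?thesis
        using x coset_mem[OF x] I.a_Hcarr by (simp add: \<phi>_def alg_homD[OF p] pI)
    qed
    have "\<phi> \<in> ?X"
      unfolding alg_hom_iff
    proof (intro conjI ballI allI)
      show "\<phi> \<in> carrier (quot_alg A I) \<rightarrow> carrier C"
        by (auto elim!: quot_carrierE simp: \<phi> alg_homD[OF p])
      show "\<phi> \<one>\<^bsub>quot_alg A I\<^esub> = \<one>\<^bsub>C\<^esub>"
        using \<phi>[OF one_closed] by (simp add: quot_one alg_homD[OF p])
      show "\<phi> \<in> extensional (carrier (quot_alg A I))"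
        by (simp add: \<phi>_def)
    qed (auto elim!: quot_carrierE simp: \<phi> alg_homD[OF p] coset_ops smult_coset)
    moreover have "p = ?F \<phi>"
      by (rule extensionalityI[OF alg_homD(6)[OF p] compose_extensional]) (simp add: compose_eq \<phi>)
    ultimately show ?thesis by blast
  qed
  ultimately show ?thesis
    unfolding bij_betw_def by blast
qed

end

text \<open>The kernel of \<open>p\<close> is an ideal, hence contains the ideal generated by \<open>S\<close> as soon as it contains
  \<open>S\<close>.\<close>

lemma (in calg) vanish_on_genideal_iff:
  assumes C: "calg C" and p: "p \<in> alg_hom B C" and S: "S \<subseteq> carrier B"
  shows "(\<forall>x\<in>Idl\<^bsub>B\<^esub> S. p x = \<zero>\<^bsub>C\<^esub>) \<longleftrightarrow> (\<forall>x\<in>S. p x = \<zero>\<^bsub>C\<^esub>)"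
proof
  assume "\<forall>x\<in>Idl\<^bsub>B\<^esub> S. p x = \<zero>\<^bsub>C\<^esub>"
  with genideal_self[OF S] show "\<forall>x\<in>S. p x = \<zero>\<^bsub>C\<^esub>" by blast
next
  interpret C: calg C by fact
  have "ring_hom_ring B C p"
    by (rule ring_hom_ringI2[OF ring_axioms C.ring_axioms]) (use p in \<open>simp add: alg_hom_def\<close>)
  then have kernel: "ideal (a_kernel B C p) B"
    by (rule ring_hom_ring.kernel_is_ideal)
  assume "\<forall>x\<in>S. p x = \<zero>\<^bsub>C\<^esub>"
  with S have "Idl\<^bsub>B\<^esub> S \<subseteq> a_kernel B C p"
    by (intro genideal_minimal[OF kernel]) (auto simp: a_kernel_def')
  then show "\<forall>x\<in>Idl\<^bsub>B\<^esub> S. p x = \<zero>\<^bsub>C\<^esub>"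
    by (auto simp: a_kernel_def')
qed

section \<open>The universal property of polynomial algebras\<close>

lemma poly_alg_simps [simp]:
  "\<zero>\<^bsub>poly_alg n\<^esub> = 0" "\<one>\<^bsub>poly_alg n\<^esub> = 1" "p \<oplus>\<^bsub>poly_alg n\<^esub> q = p + q"
  "p \<otimes>\<^bsub>poly_alg n\<^esub> q = p * q" "c \<odot>\<^bsub>poly_alg n\<^esub> p = poly_const c * p"
  by (simp_all add: poly_alg_def)

lemma poly_alg_carrier:
  "p \<in> carrier (poly_alg n) \<longleftrightarrow> (\<forall>m\<in>Poly_Mapping.keys p. Poly_Mapping.keys m \<subseteq> {1..n})"
  by (simp add: poly_alg_def)

lemma poly_alg_closed [simp]:
  shows "0 \<in> carrier (poly_alg n)" "1 \<in> carrier (poly_alg n)"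
    and "p \<in> carrier (poly_alg n) \<Longrightarrow> q \<in> carrier (poly_alg n) \<Longrightarrow> p + q \<in> carrier (poly_alg n)"
    and "p \<in> carrier (poly_alg n) \<Longrightarrow> q \<in> carrier (poly_alg n) \<Longrightarrow> p * q \<in> carrier (poly_alg n)"
    and "p \<in> carrier (poly_alg n) \<Longrightarrow> - p \<in> carrier (poly_alg n)"
    and "poly_const c \<in> carrier (poly_alg n)"
    and "i \<in> {1..n} \<Longrightarrow> poly_var i \<in> carrier (poly_alg n)"
proof -
  show "p + q \<in> carrier (poly_alg n)" if "p \<in> carrier (poly_alg n)" "q \<in> carrier (poly_alg n)"
    using that Poly_Mapping.keys_add[of p q] unfolding poly_alg_carrier by blast
  show "p * q \<in> carrier (poly_alg n)" if pq: "p \<in> carrier (poly_alg n)" "q \<in> carrier (poly_alg n)"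
    unfolding poly_alg_carrier
  proof
    fix m assume "m \<in> Poly_Mapping.keys (p * q)"
    with keys_mult[of p q] obtain a b
      where "m = a + b" "a \<in> Poly_Mapping.keys p" "b \<in> Poly_Mapping.keys q" by blast
    with pq Poly_Mapping.keys_add[of a b] show "Poly_Mapping.keys m \<subseteq> {1..n}"
      unfolding poly_alg_carrier by blast
  qed
qed (auto simp: poly_alg_carrier poly_const_def poly_var_def)

lemma poly_alg_sum_closed [simp]:
  "(\<And>i. i \<in> A \<Longrightarrow> g i \<in> carrier (poly_alg n)) \<Longrightarrow> (\<Sum>i\<in>A. g i) \<in> carrier (poly_alg n)"
  by (induction A rule: infinite_finite_induct) auto

lemma poly_const_simps:
  "poly_const (a + b) = poly_const a + poly_const b" "poly_const (a * b) = poly_const a * poly_const b"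
  "poly_const 1 = 1" "poly_const 0 = 0"
  by (simp_all add: poly_const_def single_add mult_single)

lemma poly_const_mult_single: "poly_const c * Poly_Mapping.single m d = Poly_Mapping.single m (c * d)"
  by (simp add: poly_const_def mult_single)

lemma calg_poly_alg: "calg (poly_alg n :: ('k::field, 'k mpoly) module)"
proof -
  have "cring (poly_alg n :: ('k, 'k mpoly) module)"
  proof (rule cringI)
    show "abelian_group (poly_alg n :: ('k, 'k mpoly) module)"
    proof (rule abelian_groupI)
      fix p :: "'k mpoly" assume "p \<in> carrier (poly_alg n)"
      then show "\<exists>q\<in>carrier (poly_alg n). q \<oplus>\<^bsub>poly_alg n\<^esub> p = \<zero>\<^bsub>poly_alg n\<^esub>"
        by (intro bexI[of _ "- p"]) auto
    qed (simp_all add: add_ac)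
    show "comm_monoid (poly_alg n :: ('k, 'k mpoly) module)"
      by (rule comm_monoidI) (simp_all add: mult_ac)
  qed (simp add: distrib_right)
  then have "comm_alg (poly_alg n :: ('k, 'k mpoly) module)"
    by (intro algebraI cring_from_type_algebra)
      (simp_all add: poly_const_simps distrib_left distrib_right mult_ac)
  then show ?thesis
    by (simp add: calg_def)
qed

lemma update_eq_add_single:
  fixes f :: "'a \<Rightarrow>\<^sub>0 'b::comm_monoid_add"
  assumes "a \<notin> Poly_Mapping.keys f"
  shows "Poly_Mapping.update a b f = f + Poly_Mapping.single a b"
proof (rule poly_mapping_eqI)
  fix k
  show "Poly_Mapping.lookup (Poly_Mapping.update a b f) k = Poly_Mapping.lookup (f + Poly_Mapping.single a b) k"
    using assms by (cases "k = a") (auto simp: lookup_update lookup_add lookup_single in_keys_iff)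
qed

lemma add_single_induct [case_names zero add]:
  fixes f :: "'a \<Rightarrow>\<^sub>0 'b::comm_monoid_add"
  assumes "P 0"
    and "\<And>f a b. a \<notin> Poly_Mapping.keys f \<Longrightarrow> b \<noteq> 0 \<Longrightarrow> P f \<Longrightarrow> P (f + Poly_Mapping.single a b)"
  shows "P f"
  using assms by (induction f rule: update_induct) (simp_all add: update_eq_add_single)

lemma keys_add_single:
  fixes f :: "'a \<Rightarrow>\<^sub>0 'b::comm_monoid_add"
  assumes "a \<notin> Poly_Mapping.keys f" "b \<noteq> 0"
  shows "Poly_Mapping.keys (f + Poly_Mapping.single a b) = insert a (Poly_Mapping.keys f)"
  using assms by (simp add: update_eq_add_single[symmetric] keys_update)

text \<open>Expresses that the polynomial algebra is generated by the variables: a monomial is a product of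
  variables, and a polynomial is a sum of scalar multiples of monomials.\<close>

lemma poly_alg_induct [consumes 1, case_names const var add mult]:
  fixes p :: "'k::field mpoly"
  assumes p: "p \<in> carrier (poly_alg n)"
    and const: "\<And>c. P (poly_const c)"
    and var: "\<And>i. i \<in> {1..n} \<Longrightarrow> P (poly_var i)"
    and add: "\<And>p q. p \<in> carrier (poly_alg n) \<Longrightarrow> q \<in> carrier (poly_alg n) \<Longrightarrow> P p \<Longrightarrow> P q \<Longrightarrow> P (p + q)"
    and mult: "\<And>p q. p \<in> carrier (poly_alg n) \<Longrightarrow> q \<in> carrier (poly_alg n) \<Longrightarrow> P p \<Longrightarrow> P q \<Longrightarrow> P (p * q)"
  shows "P p"
proof -
  define Q where "Q p \<longleftrightarrow> p \<in> carrier (poly_alg n) \<and> P p" for p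
  have Q_mult: "Q (p * q)" if "Q p" "Q q" for p q
    using that mult by (simp add: Q_def)
  have Q_const: "Q (poly_const c)" for c
    using const by (simp add: Q_def)
  have Q_power: "Q (Poly_Mapping.single (Poly_Mapping.single i k) 1)" if i: "i \<in> {1..n}" for i k
  proof (induction k)
    case 0
    then show ?case
      using Q_const[of 1] by (simp add: poly_const_def)
  next
    case (Suc k)
    have "(Poly_Mapping.single (Poly_Mapping.single i (Suc k)) 1 :: 'k mpoly)
      = Poly_Mapping.single (Poly_Mapping.single i k) 1 * poly_var i"
      by (simp add: poly_var_def mult_single single_add[symmetric] Suc_eq_plus1)
    moreover have "Q (poly_var i)"
      using var i by (simp add: Q_def)
    ultimately show ?case
      using Suc Q_mult by metis
  qed
  have Q_mono: "Poly_Mapping.keys m \<subseteq> {1..n} \<Longrightarrow> Q (Poly_Mapping.single m 1)" for m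
  proof (induction m rule: add_single_induct)
    case zero
    then show ?case
      using Q_const[of 1] by (simp add: poly_const_def)
  next
    case (add m i k)
    have "(Poly_Mapping.single (m + Poly_Mapping.single i k) 1 :: 'k mpoly)
      = Poly_Mapping.single m 1 * Poly_Mapping.single (Poly_Mapping.single i k) 1"
      by (simp add: mult_single)
    with add Q_mult Q_power show ?case
      by (simp add: keys_add_single)
  qed
  have "p \<in> carrier (poly_alg n) \<longrightarrow> Q p"
  proof (induction p rule: add_single_induct)
    case zero
    then show ?case
      using Q_const[of 0] by (simp add: poly_const_simps)
  next
    case (add p m c)
    show ?case
    proof
      assume "p + Poly_Mapping.single m c \<in> carrier (poly_alg n)"
      with add have p: "p \<in> carrier (poly_alg n)" and m: "Poly_Mapping.keys m \<subseteq> {1..n}"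
        by (auto simp: poly_alg_carrier keys_add_single)
      have "(Poly_Mapping.single m c :: 'k mpoly) = poly_const c * Poly_Mapping.single m 1"
        by (simp add: poly_const_mult_single)
      with Q_mult[OF Q_const Q_mono[OF m]] have "Q (Poly_Mapping.single m c)"
        by metis
      with add p assms(4) show "Q (p + Poly_Mapping.single m c)"
        by (simp add: Q_def)
    qed
  qed
  with p show ?thesis
    by (simp add: Q_def)
qed

lemma alg_hom_poly_const:
  assumes "h \<in> alg_hom (poly_alg n) B"
  shows "h (poly_const c) = c \<odot>\<^bsub>B\<^esub> \<one>\<^bsub>B\<^esub>"
  using alg_homD(5)[OF assms, of 1 c] alg_homD(4)[OF assms] by simp

lemma poly_alg_hom_eqI:
  assumes h: "h \<in> alg_hom (poly_alg n) B" and h': "h' \<in> alg_hom (poly_alg n) B"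
    and var: "\<And>i. i \<in> {1..n} \<Longrightarrow> h (poly_var i) = h' (poly_var i)"
  shows "h = h'"
proof (rule alg_hom_eqI[OF h h'])
  fix p :: "'a mpoly" assume "p \<in> carrier (poly_alg n)"
  then show "h p = h' p"
    by (induction p rule: poly_alg_induct)
      (use alg_homD(2,3)[OF h] alg_homD(2,3)[OF h'] var in
        \<open>simp_all add: alg_hom_poly_const[OF h] alg_hom_poly_const[OF h']\<close>)
qed

definition mono_eval :: "('k::field, 'u) module \<Rightarrow> nat \<Rightarrow> (nat \<Rightarrow> 'u) \<Rightarrow> (nat \<Rightarrow>\<^sub>0 nat) \<Rightarrow> 'u"
  where "mono_eval B n v m = (\<Otimes>\<^bsub>B\<^esub>i\<in>{1..n}. v i [^]\<^bsub>B\<^esub> Poly_Mapping.lookup m i)"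

text \<open>The sum is a ring homomorphism on all of \<^typ>\<open>'k mpoly\<close>, sending the variables with indices
  outside \<open>1, \<dots>, n\<close> to \<open>1\<close>; therefore multiplicativity needs no bookkeeping of variables.\<close>

definition poly_eval :: "('k::field, 'u) module \<Rightarrow> nat \<Rightarrow> (nat \<Rightarrow> 'u) \<Rightarrow> 'k mpoly \<Rightarrow> 'u"
  where "poly_eval B n v p = (\<Oplus>\<^bsub>B\<^esub>m\<in>Poly_Mapping.keys p. Poly_Mapping.lookup p m \<odot>\<^bsub>B\<^esub> mono_eval B n v m)"

locale poly_point = calg B for B :: "('k::field, 'u) module" +
  fixes n :: nat and v :: "nat \<Rightarrow> 'u"
  assumes v: "i \<in> {1..n} \<Longrightarrow> v i \<in> carrier B"
begin

lemma mono_eval_mem [simp]: "mono_eval B n v m \<in> carrier B"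
  unfolding mono_eval_def by (rule finprod_closed) (use v in auto)

lemma mono_eval_add: "mono_eval B n v (m + m') = mono_eval B n v m \<otimes>\<^bsub>B\<^esub> mono_eval B n v m'"
proof -
  have "mono_eval B n v (m + m')
    = (\<Otimes>\<^bsub>B\<^esub>i\<in>{1..n}. v i [^]\<^bsub>B\<^esub> Poly_Mapping.lookup m i \<otimes>\<^bsub>B\<^esub> v i [^]\<^bsub>B\<^esub> Poly_Mapping.lookup m' i)"
    unfolding mono_eval_def by (rule finprod_cong') (use v in \<open>auto simp: lookup_add nat_pow_mult\<close>)
  also have "\<dots> = mono_eval B n v m \<otimes>\<^bsub>B\<^esub> mono_eval B n v m'"
    unfolding mono_eval_def by (rule finprod_multf) (use v in auto)
  finally show ?thesis .
qed

lemma mono_eval_zero: "mono_eval B n v 0 = \<one>\<^bsub>B\<^esub>"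
  unfolding mono_eval_def by simp

lemma mono_eval_single:
  assumes "i \<in> {1..n}"
  shows "mono_eval B n v (Poly_Mapping.single i 1) = v i"
proof -
  have "mono_eval B n v (Poly_Mapping.single i 1) = (\<Otimes>\<^bsub>B\<^esub>j\<in>{1..n}. if i = j then v j else \<one>\<^bsub>B\<^esub>)"
    unfolding mono_eval_def
    by (rule finprod_cong') (use v in \<open>auto simp: lookup_single when_def\<close>)
  also have "\<dots> = v i"
    by (rule finprod_singleton) (use assms v in auto)
  finally show ?thesis .
qed

lemma poly_eval_mem [simp]: "poly_eval B n v p \<in> carrier B"
  unfolding poly_eval_def by (rule finsum_closed) auto

lemma poly_eval_superset:
  assumes "finite A" "Poly_Mapping.keys p \<subseteq> A"
  shows "poly_eval B n v p = (\<Oplus>\<^bsub>B\<^esub>m\<in>A. Poly_Mapping.lookup p m \<odot>\<^bsub>B\<^esub> mono_eval B n v m)"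
  unfolding poly_eval_def
  by (rule add.finprod_mono_neutral_cong_left) (use assms in \<open>auto simp: in_keys_iff\<close>)

lemma poly_eval_add: "poly_eval B n v (p + q) = poly_eval B n v p \<oplus>\<^bsub>B\<^esub> poly_eval B n v q"
proof -
  let ?A = "Poly_Mapping.keys p \<union> Poly_Mapping.keys q"
  have A: "finite ?A" by simp
  have "poly_eval B n v (p + q) = (\<Oplus>\<^bsub>B\<^esub>m\<in>?A. Poly_Mapping.lookup (p + q) m \<odot>\<^bsub>B\<^esub> mono_eval B n v m)"
    by (rule poly_eval_superset[OF A Poly_Mapping.keys_add])
  also have "\<dots> = (\<Oplus>\<^bsub>B\<^esub>m\<in>?A. Poly_Mapping.lookup p m \<odot>\<^bsub>B\<^esub> mono_eval B n v m \<oplus>\<^bsub>B\<^esub> Poly_Mapping.lookup q m \<odot>\<^bsub>B\<^esub> mono_eval B n v m)"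
    by (rule finsum_cong') (auto simp: lookup_add smult_add_left)
  also have "\<dots> = (\<Oplus>\<^bsub>B\<^esub>m\<in>?A. Poly_Mapping.lookup p m \<odot>\<^bsub>B\<^esub> mono_eval B n v m) \<oplus>\<^bsub>B\<^esub>
      (\<Oplus>\<^bsub>B\<^esub>m\<in>?A. Poly_Mapping.lookup q m \<odot>\<^bsub>B\<^esub> mono_eval B n v m)"
    by (rule finsum_addf) auto
  also have "\<dots> = poly_eval B n v p \<oplus>\<^bsub>B\<^esub> poly_eval B n v q"
    by (simp only: poly_eval_superset[OF A Un_upper1] poly_eval_superset[OF A Un_upper2])
  finally show ?thesis .
qed

lemma poly_eval_zero: "poly_eval B n v 0 = \<zero>\<^bsub>B\<^esub>"
  unfolding poly_eval_def by simp

lemma poly_eval_single: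
  "poly_eval B n v (Poly_Mapping.single m c) = c \<odot>\<^bsub>B\<^esub> mono_eval B n v m"
  by (subst poly_eval_superset[of "{m}"]) auto

lemma poly_eval_single_mult:
  "poly_eval B n v (Poly_Mapping.single m c * q) = (c \<odot>\<^bsub>B\<^esub> mono_eval B n v m) \<otimes>\<^bsub>B\<^esub> poly_eval B n v q"
proof (induction q rule: add_single_induct)
  case zero
  then show ?case by (simp add: poly_eval_zero)
next
  case (add q m' c')
  have "poly_eval B n v (Poly_Mapping.single m c * Poly_Mapping.single m' c')
    = (c \<odot>\<^bsub>B\<^esub> mono_eval B n v m) \<otimes>\<^bsub>B\<^esub> (c' \<odot>\<^bsub>B\<^esub> mono_eval B n v m')"
    by (simp add: mult_single poly_eval_single mono_eval_add smult_mult_left smult_mult_right smult_smult mult.commute)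
  with add show ?case
    by (simp add: distrib_left poly_eval_add poly_eval_single r_distr)
qed

lemma poly_eval_mult: "poly_eval B n v (p * q) = poly_eval B n v p \<otimes>\<^bsub>B\<^esub> poly_eval B n v q"
proof (induction p rule: add_single_induct)
  case zero
  then show ?case by (simp add: poly_eval_zero)
next
  case (add p m c)
  then show ?case
    by (simp add: distrib_right poly_eval_add poly_eval_single_mult poly_eval_single l_distr)
qed

lemma poly_eval_const: "poly_eval B n v (poly_const c) = c \<odot>\<^bsub>B\<^esub> \<one>\<^bsub>B\<^esub>"
  by (simp add: poly_const_def poly_eval_single mono_eval_zero)

lemma poly_eval_var: "i \<in> {1..n} \<Longrightarrow> poly_eval B n v (poly_var i) = v i"
  by (simp add: poly_var_def poly_eval_single mono_eval_single v)

lemma poly_eval_hom: "restrict (poly_eval B n v) (carrier (poly_alg n)) \<in> alg_hom (poly_alg n) B"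
proof -
  have "poly_eval B n v 1 = \<one>\<^bsub>B\<^esub>"
    using poly_eval_const[of 1] by (simp add: poly_const_simps)
  then show ?thesis
    unfolding alg_hom_iff
    by (auto simp: poly_eval_add poly_eval_mult poly_eval_const smult_mult_left)
qed

end

lemma alg_hom_poly_sum:
  fixes B :: "('k::field, 'u) module"
  assumes "calg B" and h: "h \<in> alg_hom (poly_alg n) B"
    and "finite A" "\<And>i. i \<in> A \<Longrightarrow> g i \<in> carrier (poly_alg n)"
  shows "h (\<Sum>i\<in>A. g i) = (\<Oplus>\<^bsub>B\<^esub>i\<in>A. h (g i))"
proof -
  interpret B: calg B by fact
  interpret poly: calg "poly_alg n :: ('k, 'k mpoly) module" by (rule calg_poly_alg)
  have h0: "h 0 = \<zero>\<^bsub>B\<^esub>"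
    using poly.alg_hom_to_zero[OF assms(1) h] by simp
  show ?thesis
    using assms(3,4)
  proof (induction A rule: finite_induct)
    case (insert i A)
    then show ?case
      using alg_homD(2)[OF h, of "g i" "\<Sum>i\<in>A. g i"]
      by (simp add: alg_homD(1)[OF h])
  qed (simp add: h0)
qed

section \<open>Functors of points\<close>

text \<open>A bijection compatible with the maps induced by algebra homomorphisms carries the functor laws
  from \<open>F\<close> to \<open>G\<close>. In this way the laws for \<^const>\<open>V_functor\<close> follow from those for functors of
  homomorphisms, where they are laws for composition.\<close>

lemma natural_iso_transport:
  fixes F :: "('k::field, 'u, 'x) set_functor" and G :: "('k, 'u, 'y) set_functor"
  assumes F: "is_functor F"
    and bij: "\<And>B. comm_alg B \<Longrightarrow> bij_betw (\<theta> B) (obj F B) (obj G B)"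
    and nat: "\<And>B C g x. comm_alg B \<Longrightarrow> comm_alg C \<Longrightarrow> g \<in> alg_hom B C \<Longrightarrow> x \<in> obj F B \<Longrightarrow>
      \<theta> C (arr F B C g x) = arr G B C g (\<theta> B x)"
  shows "natural_iso F G \<theta>"
proof -
  have F_id: "arr F B B (alg_id B) x = x" if "comm_alg B" "x \<in> obj F B" for B x
    using F that unfolding is_functor_def by blast
  have F_arr: "arr F B C g x \<in> obj F C"
    if "comm_alg B" "comm_alg C" "g \<in> alg_hom B C" "x \<in> obj F B" for B C g x
    using F that unfolding is_functor_def by blast
  have F_comp: "arr F B D (compose (carrier B) h g) x = arr F C D h (arr F B C g x)"
    if "comm_alg B" "comm_alg C" "comm_alg D" "g \<in> alg_hom B C" "h \<in> alg_hom C D" "x \<in> obj F B"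
    for B C D g h x
    using F that unfolding is_functor_def by blast
  have \<theta>: "\<theta> B x \<in> obj G B" if "comm_alg B" "x \<in> obj F B" for B x
    using bij[OF that(1)] that(2) by (rule bij_betwE[THEN bspec])
  have G_obj: "\<exists>x\<in>obj F B. y = \<theta> B x" if "comm_alg B" "y \<in> obj G B" for B y
    using bij_betw_imp_surj_on[OF bij[OF that(1)]] that(2) by blast
  have "is_functor G"
    unfolding is_functor_def
  proof (intro conjI allI impI ballI)
    fix B :: "('k, 'u) module" and y assume B: "comm_alg B" and "y \<in> obj G B"
    then obtain x where x: "x \<in> obj F B" "y = \<theta> B x"
      using G_obj by blast
    have "alg_id B \<in> alg_hom B B"
      using calg.alg_id_hom[OF calgI[OF B]] .
    from nat[OF B B this x(1)] x show "arr G B B (alg_id B) y = y"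
      by (simp add: F_id[OF B x(1)])
  next
    fix B C :: "('k, 'u) module" and g assume h: "comm_alg B \<and> comm_alg C \<and> g \<in> alg_hom B C"
    show "arr G B C g \<in> obj G B \<rightarrow> obj G C"
    proof
      fix y assume "y \<in> obj G B"
      with h obtain x where x: "x \<in> obj F B" "y = \<theta> B x"
        using G_obj by blast
      with h nat[of B C g x] \<theta>[of C "arr F B C g x"] F_arr[of B C g x]
      show "arr G B C g y \<in> obj G C" by simp
    qed
  next
    fix B C D :: "('k, 'u) module" and g h y
    assume h: "comm_alg B \<and> comm_alg C \<and> comm_alg D \<and> g \<in> alg_hom B C \<and> h \<in> alg_hom C D"
      and "y \<in> obj G B"
    then obtain x where x: "x \<in> obj F B" "y = \<theta> B x"
      using G_obj by blast
    have "compose (carrier B) h g \<in> alg_hom B D"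
      using h by (blast intro: calg.alg_hom_compose calgI)
    with h x have "arr G B D (compose (carrier B) h g) y = \<theta> D (arr F C D h (arr F B C g x))"
      using nat[of B D "compose (carrier B) h g" x] F_comp[of B C D g h x] by simp
    also have "\<dots> = arr G C D h (arr G B C g y)"
      using h x nat[of C D h "arr F B C g x"] nat[of B C g x] F_arr[of B C g x] by simp
    finally show "arr G B D (compose (carrier B) h g) y = arr G C D h (arr G B C g y)" .
  qed
  with F \<theta> nat bij show ?thesis
    unfolding natural_iso_def natural_trans_def by blast
qed

lemma is_functor_sub:
  assumes F: "is_functor F" and "arr F' = arr F"
    and "\<And>B. comm_alg B \<Longrightarrow> obj F' B \<subseteq> obj F B"
    and "\<And>B C g x. comm_alg B \<Longrightarrow> comm_alg C \<Longrightarrow> g \<in> alg_hom B C \<Longrightarrow> x \<in> obj F' B \<Longrightarrow>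
      arr F B C g x \<in> obj F' C"
  shows "is_functor F'"
  using assms unfolding is_functor_def by (simp add: Pi_iff subset_iff)

section \<open>Points of affine space as tensors\<close>

context based_tensor
begin

lemma
  assumes p: "p \<in> alg_hom (poly_alg n) B"
  shows basis_point_mem: "basis_point M n e B p \<in> carrier (tensor M B)"
    and tcoord_basis_point: "i \<in> {1..n} \<Longrightarrow> tcoord M n e B i (basis_point M n e B p) = p (poly_var i)"
proof -
  have v: "(\<lambda>i. p (poly_var i)) \<in> {1..n} \<rightarrow> carrier B"
    using alg_homD(1)[OF p] by simp
  then show "basis_point M n e B p \<in> carrier (tensor M B)"
    unfolding basis_point_def by (intro T.finsum_closed) (auto intro!: pure_mem alg_homD(1)[OF p])
  show "i \<in> {1..n} \<Longrightarrow> tcoord M n e B i (basis_point M n e B p) = p (poly_var i)"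
    unfolding basis_point_def by (rule tcoord_basis_finsum[OF v])
qed

text \<open>Both sides are identified with \<open>n\<close>-tuples in \<open>B\<close>: a homomorphism with its values on the variables,
  a tensor with its coordinates.\<close>

lemma basis_point_bij:
  "bij_betw (basis_point M n e B) (alg_hom (poly_alg n) B) (carrier (tensor M B))"
proof (rule bij_betw_imageI)
  show "inj_on (basis_point M n e B) (alg_hom (poly_alg n) B)"
  proof (rule inj_onI)
    fix p q assume pq: "p \<in> alg_hom (poly_alg n) B" "q \<in> alg_hom (poly_alg n) B"
      and "basis_point M n e B p = basis_point M n e B q"
    with tcoord_basis_point[OF pq(1)] tcoord_basis_point[OF pq(2)] show "p = q"
      by (intro poly_alg_hom_eqI[OF pq]) simp
  qed
  show "basis_point M n e B ` alg_hom (poly_alg n) B = carrier (tensor M B)"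
  proof (intro equalityI subsetI)
    fix S assume S: "S \<in> carrier (tensor M B)"
    interpret pt: poly_point B n "\<lambda>i. tcoord M n e B i S"
      by unfold_locales (use S in simp)
    let ?p = "restrict (poly_eval B n (\<lambda>i. tcoord M n e B i S)) (carrier (poly_alg n))"
    have "S = basis_point M n e B ?p"
      by (rule tensor_eqI[OF S basis_point_mem[OF pt.poly_eval_hom]])
        (simp add: tcoord_basis_point[OF pt.poly_eval_hom] pt.poly_eval_var)
    with pt.poly_eval_hom show "S \<in> basis_point M n e B ` alg_hom (poly_alg n) B"
      by blast
  qed (use basis_point_mem in blast)
qed

lemma basis_point_natural:
  assumes C: "calg C" and g: "g \<in> alg_hom B C" and p: "p \<in> alg_hom (poly_alg n) B"
  shows "basis_point M n e C (compose (carrier (poly_alg n)) g p)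
    = tensor_map M C (\<lambda>x. x) g (basis_point M n e B p)"
proof -
  interpret C: calg C by fact
  interpret tgt: based_tensor M n e C ..
  note gp = calg.alg_hom_compose[OF calg_poly_alg p g]
  note bp = basis_point_mem[OF p]
  show ?thesis
  proof (rule tgt.tensor_eqI)
    show "basis_point M n e C (compose (carrier (poly_alg n)) g p) \<in> carrier (tensor M C)"
      by (rule tgt.basis_point_mem[OF gp])
    show "tensor_map M C (\<lambda>x. x) g (basis_point M n e B p) \<in> carrier (tensor M C)"
      by (rule tensor_map_id_mem[OF C alg_hom_lin_map[OF g] bp])
    fix i assume i: "i \<in> {1..n}"
    have "tcoord M n e C i (basis_point M n e C (compose (carrier (poly_alg n)) g p)) = g (p (poly_var i))"
      using tgt.tcoord_basis_point[OF gp i] i by (simp add: compose_eq)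
    also have "\<dots> = tcoord M n e C i (tensor_map M C (\<lambda>x. x) g (basis_point M n e B p))"
      by (simp only: tcoord_tensor_map_id[OF C alg_hom_lin_map[OF g] bp i] tcoord_basis_point[OF p i])
    finally show "tcoord M n e C i (basis_point M n e C (compose (carrier (poly_alg n)) g p))
      = tcoord M n e C i (tensor_map M C (\<lambda>x. x) g (basis_point M n e B p))" .
  qed
qed

end

section \<open>The curvature in coordinates\<close>

text \<open>The coordinate functions of the curvature, i.e. the images of the \<open>y\<^sub>l\<close> under its
  comorphism (lemma \<open>comorphism_courb\<close>).\<close>

definition curvature_poly ::
    "nat \<Rightarrow> (nat \<Rightarrow> nat \<Rightarrow> nat \<Rightarrow> 'k::field) \<Rightarrow> (nat \<Rightarrow> nat \<Rightarrow> 'k) \<Rightarrow> nat \<Rightarrow> 'k mpoly"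
  where "curvature_poly r a b l = (\<Sum>i=1..r. poly_const (b i l) * poly_var i)
    + (\<Sum>i=1..r. \<Sum>j=1..r. poly_const (a i j l) * poly_var i * poly_var j)"

locale curvature_coordinates = dg_category P
  for P :: "('o, 'k::field, 'v) dg_data" +
  fixes E :: 'o and r s :: nat and e f :: "nat \<Rightarrow> 'v"
    and a :: "nat \<Rightarrow> nat \<Rightarrow> nat \<Rightarrow> 'k" and b :: "nat \<Rightarrow> nat \<Rightarrow> 'k"
  assumes E: "E \<in> Ob P"
    and basis1: "is_basis (Hom P E E 1) r e" and basis2: "is_basis (Hom P E E 2) s f"
    and cmp_basis: "i \<in> {1..r} \<Longrightarrow> j \<in> {1..r} \<Longrightarrow> cmp P E E E 1 1 (e i) (e j)
      = (\<Oplus>\<^bsub>Hom P E E 2\<^esub> l\<in>{1..s}. a i j l \<odot>\<^bsub>Hom P E E 2\<^esub> f l)"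
    and diff_basis: "i \<in> {1..r} \<Longrightarrow> diff P E E 1 (e i)
      = (\<Oplus>\<^bsub>Hom P E E 2\<^esub> l\<in>{1..s}. b i l \<odot>\<^bsub>Hom P E E 2\<^esub> f l)"
begin

sublocale M1: based_vspace "Hom P E E 1" r e
  using Hom_module[OF E E] basis1 by (simp add: based_vspace_def based_vspace_axioms_def vspace_def)

sublocale M2: based_vspace "Hom P E E 2" s f
  using Hom_module[OF E E] basis2 by (simp add: based_vspace_def based_vspace_axioms_def vspace_def)

lemma based1: "calg B \<Longrightarrow> based_tensor (Hom P E E 1) r e B"
  by (simp add: based_tensor_def tensor_pair_def M1.based_vspace_axioms M1.vspace_axioms)

lemma based2: "calg B \<Longrightarrow> based_tensor (Hom P E E 2) s f B"
  by (simp add: based_tensor_def tensor_pair_def M2.based_vspace_axioms M2.vspace_axioms)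

lemma diff_lin: "lin_map (Hom P E E 1) (Hom P E E 2) (diff P E E 1)"
  unfolding lin_map_def
  using diff_closed[OF E E, of _ 1] diff_add[OF E E, of _ 1] diff_smult[OF E E, of _ 1] by simp

lemma cmp_lin_left:
  "y \<in> carrier (Hom P E E 1) \<Longrightarrow> lin_map (Hom P E E 1) (Hom P E E 2) (\<lambda>x. cmp P E E E 1 1 x y)"
  unfolding lin_map_def
  using cmp_closed[OF E E E, of _ 1 _ 1] cmp_add_left[OF E E E, of _ 1 _ _ 1]
    cmp_smult_left[OF E E E, of _ 1 _ 1] by simp

lemma cmp_lin_right:
  "x \<in> carrier (Hom P E E 1) \<Longrightarrow> lin_map (Hom P E E 1) (Hom P E E 2) (cmp P E E E 1 1 x)"
  unfolding lin_map_def
  using cmp_closed[OF E E E, of _ 1 _ 1] cmp_add_right[OF E E E, of _ 1 _ 1]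
    cmp_smult_right[OF E E E, of _ 1 _ 1] by simp

text \<open>The numbers \<open>b i l\<close> are the matrix of the differential and the \<open>a i j l\<close> the structure
  constants of the composition, so the general coordinate formulas for \<^const>\<open>tensor_map\<close> and
  \<^const>\<open>tensor_mult\<close> give the two summands.\<close>

lemma
  assumes B: "calg B" and \<sigma>: "\<sigma> \<in> carrier (tensor (Hom P E E 1) B)"
  defines "x \<equiv> \<lambda>i. tcoord (Hom P E E 1) r e B i \<sigma>"
  shows curvature_mem: "curvature P E B \<sigma> \<in> carrier (tensor (Hom P E E 2) B)"
    and tcoord_curvature: "l \<in> {1..s} \<Longrightarrow> tcoord (Hom P E E 2) s f B l (curvature P E B \<sigma>)
      = (\<Oplus>\<^bsub>B\<^esub>i\<in>{1..r}. b i l \<odot>\<^bsub>B\<^esub> x i) \<oplus>\<^bsub>B\<^esub>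
        (\<Oplus>\<^bsub>B\<^esub>j\<in>{1..r}. \<Oplus>\<^bsub>B\<^esub>i\<in>{1..r}. a i j l \<odot>\<^bsub>B\<^esub> (x i \<otimes>\<^bsub>B\<^esub> x j))"
proof -
  interpret t1: based_tensor "Hom P E E 1" r e B by (rule based1[OF B])
  interpret t2: based_tensor "Hom P E E 2" s f B by (rule based2[OF B])
  interpret mor: tensor_morphism "Hom P E E 1" r e B "Hom P E E 2" s f B ..
  interpret prod: tensor_product_map "Hom P E E 1" r e "Hom P E E 1" r e "Hom P E E 2" s f B
    "cmp P E E E 1 1"
    by unfold_locales (simp_all add: cmp_lin_left cmp_lin_right)
  have id: "lin_map B B (\<lambda>y. y)"
    by (simp add: lin_map_def)
  note d = mor.tensor_map_mem[OF diff_lin id \<sigma>] mor.tcoord_tensor_map[OF diff_lin id \<sigma>]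
  note m = prod.tensor_mult_mem[OF \<sigma> \<sigma>] prod.tcoord_tensor_mult[OF \<sigma> \<sigma>]
  show "curvature P E B \<sigma> \<in> carrier (tensor (Hom P E E 2) B)"
    unfolding curvature_def using d(1) m(1) by (rule t2.T.a_closed)
  assume l: "l \<in> {1..s}"
  have "tcoord (Hom P E E 2) s f B l (tensor_map (Hom P E E 2) B (diff P E E 1) (\<lambda>b. b) \<sigma>)
    = (\<Oplus>\<^bsub>B\<^esub>i\<in>{1..r}. b i l \<odot>\<^bsub>B\<^esub> x i)"
    unfolding d(2)[OF l]
    by (rule t1.B.finsum_cong') (use l \<sigma> in \<open>auto simp: x_def diff_basis M2.coord_lincomb\<close>)
  moreover have "tcoord (Hom P E E 2) s f B l (tensor_mult (Hom P E E 2) B (cmp P E E E 1 1) \<sigma> \<sigma>)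
    = (\<Oplus>\<^bsub>B\<^esub>j\<in>{1..r}. \<Oplus>\<^bsub>B\<^esub>i\<in>{1..r}. a i j l \<odot>\<^bsub>B\<^esub> (x i \<otimes>\<^bsub>B\<^esub> x j))"
    unfolding m(2)[OF l]
    by (intro t1.B.finsum_cong')
      (use l \<sigma> in \<open>auto simp: x_def cmp_basis M2.coord_lincomb intro!: t1.B.finsum_closed\<close>)
  ultimately show "tcoord (Hom P E E 2) s f B l (curvature P E B \<sigma>)
      = (\<Oplus>\<^bsub>B\<^esub>i\<in>{1..r}. b i l \<odot>\<^bsub>B\<^esub> x i) \<oplus>\<^bsub>B\<^esub>
        (\<Oplus>\<^bsub>B\<^esub>j\<in>{1..r}. \<Oplus>\<^bsub>B\<^esub>i\<in>{1..r}. a i j l \<odot>\<^bsub>B\<^esub> (x i \<otimes>\<^bsub>B\<^esub> x j))"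
    unfolding curvature_def using t2.tcoord_add[OF l d(1) m(1)] by simp
qed

lemma curvature_poly_mem: "curvature_poly r a b l \<in> carrier (poly_alg r)"
  unfolding curvature_poly_def by (intro poly_alg_closed poly_alg_sum_closed)

text \<open>The double sum is written with the right factor \<open>j\<close> outside, since this is the order in which
  \<open>tcoord_curvature\<close> yields it.\<close>

lemma eval_curvature_poly:
  assumes B: "calg B" and p: "p \<in> alg_hom (poly_alg r) B"
  shows "p (curvature_poly r a b l) = (\<Oplus>\<^bsub>B\<^esub>i\<in>{1..r}. b i l \<odot>\<^bsub>B\<^esub> p (poly_var i)) \<oplus>\<^bsub>B\<^esub>
    (\<Oplus>\<^bsub>B\<^esub>j\<in>{1..r}. \<Oplus>\<^bsub>B\<^esub>i\<in>{1..r}. a i j l \<odot>\<^bsub>B\<^esub> (p (poly_var i) \<otimes>\<^bsub>B\<^esub> p (poly_var j)))"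
proof -
  interpret B: calg B by fact
  note sum = alg_hom_poly_sum[OF B p]
  have p_mem: "p (poly_var i) \<in> carrier B" if "i \<in> {1..r}" for i
    using that alg_homD(1)[OF p] by simp
  have smult: "p (poly_const c * q) = c \<odot>\<^bsub>B\<^esub> p q" if "q \<in> carrier (poly_alg r)" for c q
    using alg_homD(5)[OF p that] by simp
  have mult: "p (poly_var i * poly_var j) = p (poly_var i) \<otimes>\<^bsub>B\<^esub> p (poly_var j)"
    if "i \<in> {1..r}" "j \<in> {1..r}" for i j
    using alg_homD(3)[OF p, of "poly_var i" "poly_var j"] that by simp
  have "curvature_poly r a b l = (\<Sum>i=1..r. poly_const (b i l) * poly_var i)
    + (\<Sum>j=1..r. \<Sum>i=1..r. poly_const (a i j l) * (poly_var i * poly_var j))"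
    unfolding curvature_poly_def by (subst (2) sum.swap) (simp add: mult.assoc)
  moreover have "(\<Sum>i=1..r. poly_const (b i l) * poly_var i) \<in> carrier (poly_alg r)"
    and "(\<Sum>j=1..r. \<Sum>i=1..r. poly_const (a i j l) * (poly_var i * poly_var j)) \<in> carrier (poly_alg r)"
    by (intro poly_alg_closed poly_alg_sum_closed; assumption)+
  ultimately have "p (curvature_poly r a b l) = p (\<Sum>i=1..r. poly_const (b i l) * poly_var i)
    \<oplus>\<^bsub>B\<^esub> p (\<Sum>j=1..r. \<Sum>i=1..r. poly_const (a i j l) * (poly_var i * poly_var j))"
    using alg_homD(2)[OF p] by simp
  also have "p (\<Sum>i=1..r. poly_const (b i l) * poly_var i) = (\<Oplus>\<^bsub>B\<^esub>i\<in>{1..r}. b i l \<odot>\<^bsub>B\<^esub> p (poly_var i))"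
    by (subst sum) (auto intro!: B.finsum_cong' simp: smult p_mem)
  also have "p (\<Sum>j=1..r. \<Sum>i=1..r. poly_const (a i j l) * (poly_var i * poly_var j))
    = (\<Oplus>\<^bsub>B\<^esub>j\<in>{1..r}. p (\<Sum>i=1..r. poly_const (a i j l) * (poly_var i * poly_var j)))"
    by (rule sum) (auto intro!: poly_alg_sum_closed)
  also have "\<dots> = (\<Oplus>\<^bsub>B\<^esub>j\<in>{1..r}. \<Oplus>\<^bsub>B\<^esub>i\<in>{1..r}. a i j l \<odot>\<^bsub>B\<^esub> (p (poly_var i) \<otimes>\<^bsub>B\<^esub> p (poly_var j)))"
  proof (rule B.finsum_cong'[OF refl])
    show "(\<lambda>j. \<Oplus>\<^bsub>B\<^esub>i\<in>{1..r}. a i j l \<odot>\<^bsub>B\<^esub> (p (poly_var i) \<otimes>\<^bsub>B\<^esub> p (poly_var j))) \<in> {1..r} \<rightarrow> carrier B"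
      by (auto intro!: B.finsum_closed simp: p_mem)
    fix j assume "j \<in> {1..r}"
    then show "p (\<Sum>i=1..r. poly_const (a i j l) * (poly_var i * poly_var j))
      = (\<Oplus>\<^bsub>B\<^esub>i\<in>{1..r}. a i j l \<odot>\<^bsub>B\<^esub> (p (poly_var i) \<otimes>\<^bsub>B\<^esub> p (poly_var j)))"
      by (subst sum) (auto intro!: B.finsum_cong' simp: smult mult p_mem)
  qed
  finally show ?thesis .
qed

lemma tcoord_curvature_point:
  assumes B: "calg B" and p: "p \<in> alg_hom (poly_alg r) B" and l: "l \<in> {1..s}"
  shows "tcoord (Hom P E E 2) s f B l (curvature P E B (basis_point (Hom P E E 1) r e B p))
    = p (curvature_poly r a b l)"
proof -
  interpret t1: based_tensor "Hom P E E 1" r e B by (rule based1[OF B])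
  have p_mem: "p (poly_var i) \<in> carrier B" if "i \<in> {1..r}" for i
    using that alg_homD(1)[OF p] by simp
  have "(\<Oplus>\<^bsub>B\<^esub>i\<in>{1..r}. b i l \<odot>\<^bsub>B\<^esub> tcoord (Hom P E E 1) r e B i (basis_point (Hom P E E 1) r e B p))
    = (\<Oplus>\<^bsub>B\<^esub>i\<in>{1..r}. b i l \<odot>\<^bsub>B\<^esub> p (poly_var i))"
    by (rule t1.B.finsum_cong') (auto simp: t1.tcoord_basis_point[OF p] p_mem)
  moreover have "(\<Oplus>\<^bsub>B\<^esub>j\<in>{1..r}. \<Oplus>\<^bsub>B\<^esub>i\<in>{1..r}. a i j l \<odot>\<^bsub>B\<^esub>
      (tcoord (Hom P E E 1) r e B i (basis_point (Hom P E E 1) r e B p) \<otimes>\<^bsub>B\<^esub>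
       tcoord (Hom P E E 1) r e B j (basis_point (Hom P E E 1) r e B p)))
    = (\<Oplus>\<^bsub>B\<^esub>j\<in>{1..r}. \<Oplus>\<^bsub>B\<^esub>i\<in>{1..r}. a i j l \<odot>\<^bsub>B\<^esub> (p (poly_var i) \<otimes>\<^bsub>B\<^esub> p (poly_var j)))"
    by (intro t1.B.finsum_cong') (auto simp: t1.tcoord_basis_point[OF p] p_mem intro!: t1.B.finsum_closed)
  ultimately show ?thesis
    using tcoord_curvature[OF B t1.basis_point_mem[OF p] l] eval_curvature_poly[OF B p]
    by simp
qed

lemma
  assumes B: "calg B" and p: "p \<in> alg_hom (poly_alg r) B"
  shows courb_hom: "courb P E r e s f B p \<in> alg_hom (poly_alg s) B"
    and courb_var: "l \<in> {1..s} \<Longrightarrow> courb P E r e s f B p (poly_var l) = p (curvature_poly r a b l)"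
proof -
  interpret t1: based_tensor "Hom P E E 1" r e B by (rule based1[OF B])
  interpret t2: based_tensor "Hom P E E 2" s f B by (rule based2[OF B])
  let ?\<kappa> = "curvature P E B (basis_point (Hom P E E 1) r e B p)"
  have "?\<kappa> \<in> basis_point (Hom P E E 2) s f B ` alg_hom (poly_alg s) B"
    using bij_betw_imp_surj_on[OF t2.basis_point_bij] curvature_mem[OF B t1.basis_point_mem[OF p]]
    by simp
  note inv = inv_into_into[OF this] f_inv_into_f[OF this]
  from inv(1) show hom: "courb P E r e s f B p \<in> alg_hom (poly_alg s) B"
    by (simp add: courb_def Spec_def)
  have "basis_point (Hom P E E 2) s f B (courb P E r e s f B p) = ?\<kappa>"
    using inv(2) by (simp add: courb_def Spec_def)
  then show "l \<in> {1..s} \<Longrightarrow> courb P E r e s f B p (poly_var l) = p (curvature_poly r a b l)"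
    using t2.tcoord_basis_point[OF hom] tcoord_curvature_point[OF B p] by metis
qed

text \<open>The universal point \<^const>\<open>alg_id\<close> sends every polynomial to itself, so the value of
  \<^const>\<open>courb\<close> there records the polynomials themselves.\<close>

lemma comorphism_courb:
  fixes cb_star
  defines "cb_star \<equiv> comorphism (poly_alg r) (courb P E r e s f)"
  shows comorphism_courb_hom: "cb_star \<in> alg_hom (poly_alg s) (poly_alg r)"
    and comorphism_courb_var: "l \<in> {1..s} \<Longrightarrow> cb_star (poly_var l) = curvature_poly r a b l"
proof -
  have id: "alg_id (poly_alg r) \<in> alg_hom (poly_alg r) (poly_alg r :: ('k, 'k mpoly) module)"
    by (rule calg.alg_id_hom[OF calg_poly_alg])
  show "cb_star \<in> alg_hom (poly_alg s) (poly_alg r)"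
    unfolding cb_star_def comorphism_def by (rule courb_hom[OF calg_poly_alg id])
  show "l \<in> {1..s} \<Longrightarrow> cb_star (poly_var l) = curvature_poly r a b l"
    unfolding cb_star_def comorphism_def
    using courb_var[OF calg_poly_alg id, of l] curvature_poly_mem[of l] by (simp add: alg_id_def)
qed

lemma courb_compose:
  assumes B: "calg B" and p: "p \<in> alg_hom (poly_alg r) B"
  shows "courb P E r e s f B p
    = compose (carrier (poly_alg s)) p (comorphism (poly_alg r) (courb P E r e s f))"
  by (rule poly_alg_hom_eqI[OF courb_hom[OF B p]
        calg.alg_hom_compose[OF calg_poly_alg comorphism_courb_hom p]])
    (simp add: courb_var[OF B p] compose_eq comorphism_courb_var)

text \<open>A tensor in degree 2 vanishes if and only if its coordinates do, and those of the curvature of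
  the point \<open>p\<close> are the \<open>p (curvature_poly r a b l)\<close>.\<close>

lemma zero_locus_bij:
  assumes B: "calg B"
  shows "bij_betw (basis_point (Hom P E E 1) r e B)
    {p \<in> alg_hom (poly_alg r) B. \<forall>l\<in>{1..s}. p (curvature_poly r a b l) = \<zero>\<^bsub>B\<^esub>}
    (obj (V_functor P E) B)"
proof -
  interpret t1: based_tensor "Hom P E E 1" r e B by (rule based1[OF B])
  interpret t2: based_tensor "Hom P E E 2" s f B by (rule based2[OF B])
  have "curvature P E B (basis_point (Hom P E E 1) r e B p) = \<zero>\<^bsub>tensor (Hom P E E 2) B\<^esub> \<longleftrightarrow>
      (\<forall>l\<in>{1..s}. p (curvature_poly r a b l) = \<zero>\<^bsub>B\<^esub>)" (is "?\<kappa> = _ \<longleftrightarrow> ?R")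
    if p: "p \<in> alg_hom (poly_alg r) B" for p
  proof
    assume "?\<kappa> = \<zero>\<^bsub>tensor (Hom P E E 2) B\<^esub>"
    then show ?R
      using tcoord_curvature_point[OF B p] by simp
  next
    assume ?R
    then show "?\<kappa> = \<zero>\<^bsub>tensor (Hom P E E 2) B\<^esub>"
      using tcoord_curvature_point[OF B p] curvature_mem[OF B t1.basis_point_mem[OF p]]
      by (intro t2.tensor_eqI) simp_all
  qed
  then show ?thesis
    unfolding V_functor_def by (simp add: bij_betw_Collect[OF t1.basis_point_bij])
qed

lemma courb_natural: "natural_trans (Spec (poly_alg r)) (Spec (poly_alg s)) (courb P E r e s f)"
  unfolding natural_trans_def
proof (intro conjI allI impI ballI)
  show "is_functor (Spec (poly_alg r) :: ('k, 'u, 'k mpoly \<Rightarrow> 'u) set_functor)"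
    and "is_functor (Spec (poly_alg s) :: ('k, 'u, 'k mpoly \<Rightarrow> 'u) set_functor)"
    by (rule calg.is_functor_Spec[OF calg_poly_alg])+
  fix B :: "('k, 'u) module" assume "comm_alg B"
  then show "courb P E r e s f B \<in> obj (Spec (poly_alg r)) B \<rightarrow> obj (Spec (poly_alg s)) B"
    by (simp add: Spec_def Pi_iff courb_hom calgI)
next
  fix B C :: "('k, 'u) module" and g p
  assume h: "comm_alg B \<and> comm_alg C \<and> g \<in> alg_hom B C" and "p \<in> obj (Spec (poly_alg r)) B"
  then have B: "calg B" and C: "calg C" and g: "g \<in> alg_hom B C" and p: "p \<in> alg_hom (poly_alg r) B"
    by (simp_all add: calgI Spec_def)
  note gp = calg.alg_hom_compose[OF calg_poly_alg p g]
  have "courb P E r e s f C (compose (carrier (poly_alg r)) g p)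
    = compose (carrier (poly_alg s)) g (courb P E r e s f B p)"
    by (rule poly_alg_hom_eqI[OF courb_hom[OF C gp]
          calg.alg_hom_compose[OF calg_poly_alg courb_hom[OF B p] g]])
      (simp add: courb_var[OF C gp] courb_var[OF B p] compose_eq curvature_poly_mem)
  then show "courb P E r e s f C (arr (Spec (poly_alg r)) B C g p)
    = arr (Spec (poly_alg s)) B C g (courb P E r e s f B p)"
    by (simp add: Spec_def)
qed

lemma preimage_origin_obj:
  assumes "comm_alg B"
  shows "obj (preimage_functor (Spec (poly_alg r)) (courb P E r e s f) (origin s)) B
    = {p \<in> alg_hom (poly_alg r) B. \<forall>l\<in>{1..s}. p (curvature_poly r a b l) = \<zero>\<^bsub>B\<^esub>}"
  using courb_hom[OF calgI[OF assms]] courb_var[OF calgI[OF assms]]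
  by (auto simp: preimage_functor_def origin_def Spec_def)

lemma preimage_origin_iso:
  "natural_iso (preimage_functor (Spec (poly_alg r)) (courb P E r e s f) (origin s))
    (V_functor P E) (basis_point (Hom P E E 1) r e)"
proof (rule natural_iso_transport)
  let ?F = "preimage_functor (Spec (poly_alg r)) (courb P E r e s f) (origin s)
    :: ('k, 'u, 'k mpoly \<Rightarrow> 'u) set_functor"
  show "is_functor ?F"
  proof (rule is_functor_sub[OF calg.is_functor_Spec[OF calg_poly_alg]])
    show "arr ?F = arr (Spec (poly_alg r))"
      by (simp add: preimage_functor_def)
    show "obj ?F B \<subseteq> obj (Spec (poly_alg r)) B" for B
      by (auto simp: preimage_functor_def)
    fix B C :: "('k, 'u) module" and g p
    assume B: "comm_alg B" and C: "comm_alg C" and g: "g \<in> alg_hom B C" and "p \<in> obj ?F B"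
    then have p: "p \<in> alg_hom (poly_alg r) B"
      and zero: "\<And>l. l \<in> {1..s} \<Longrightarrow> p (curvature_poly r a b l) = \<zero>\<^bsub>B\<^esub>"
      by (simp_all add: preimage_origin_obj)
    have "g \<zero>\<^bsub>B\<^esub> = \<zero>\<^bsub>C\<^esub>"
      by (rule calg.alg_hom_to_zero[OF calgI[OF B] calgI[OF C] g])
    with zero calg.alg_hom_compose[OF calg_poly_alg p g]
    show "arr (Spec (poly_alg r)) B C g p \<in> obj ?F C"
      by (simp add: preimage_origin_obj[OF C]) (simp add: Spec_def compose_eq curvature_poly_mem)
  qed
next
  fix B :: "('k, 'u) module" assume "comm_alg B"
  then show "bij_betw (basis_point (Hom P E E 1) r e B)
    (obj (preimage_functor (Spec (poly_alg r)) (courb P E r e s f) (origin s)) B) (obj (V_functor P E) B)"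
    by (simp add: preimage_origin_obj zero_locus_bij calgI)
next
  fix B C :: "('k, 'u) module" and g p
  assume "comm_alg B" "comm_alg C" "g \<in> alg_hom B C"
    and "p \<in> obj (preimage_functor (Spec (poly_alg r)) (courb P E r e s f) (origin s)) B"
  then show "basis_point (Hom P E E 1) r e C
      (arr (preimage_functor (Spec (poly_alg r)) (courb P E r e s f) (origin s)) B C g p)
    = arr (V_functor P E) B C g (basis_point (Hom P E E 1) r e B p)"
    by (simp add: preimage_functor_def Spec_def V_functor_def calgI
        based_tensor.basis_point_natural[OF based1])
qed

text \<open>Homomorphisms from the quotient are the homomorphisms \<open>p\<close> that kill the generators of \<open>I\<close>, and
  those are the points of the zero locus.\<close>

lemma quotient_iso:
  defines "I \<equiv> Idl\<^bsub>poly_alg r\<^esub> (curvature_poly r a b ` {1..s})"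
  shows "natural_iso (Spec (quot_alg (poly_alg r) I)) (V_functor P E)
    (\<lambda>B \<phi>. basis_point (Hom P E E 1) r e B (compose (carrier (poly_alg r)) \<phi> (\<lambda>x. I +>\<^bsub>poly_alg r\<^esub> x)))"
proof (rule natural_iso_transport)
  interpret poly: calg "poly_alg r :: ('k, 'k mpoly) module"
    by (rule calg_poly_alg)
  have gens: "curvature_poly r a b ` {1..s} \<subseteq> carrier (poly_alg r)"
    using curvature_poly_mem by blast
  have "ideal I (poly_alg r)"
    unfolding I_def by (rule poly.genideal_ideal[OF gens])
  then interpret quot: calg_ideal "poly_alg r :: ('k, 'k mpoly) module" I
    by (intro calg_ideal.intro calg_poly_alg)
  show "is_functor (Spec (quot_alg (poly_alg r) I))"
    by (rule quot.quot.is_functor_Spec)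
  fix B :: "('k, 'u) module" assume "comm_alg B"
  then have B: "calg B" by (rule calgI)
  have "bij_betw (\<lambda>\<phi>. compose (carrier (poly_alg r)) \<phi> (\<lambda>x. I +>\<^bsub>poly_alg r\<^esub> x))
    (alg_hom (quot_alg (poly_alg r) I) B)
    {p \<in> alg_hom (poly_alg r) B. \<forall>l\<in>{1..s}. p (curvature_poly r a b l) = \<zero>\<^bsub>B\<^esub>}"
    using quot.quot_universal[OF B] poly.vanish_on_genideal_iff[OF B _ gens, folded I_def]
    by (simp cong: conj_cong)
  from bij_betw_trans[OF this zero_locus_bij[OF B]]
  show "bij_betw (\<lambda>\<phi>. basis_point (Hom P E E 1) r e B
      (compose (carrier (poly_alg r)) \<phi> (\<lambda>x. I +>\<^bsub>poly_alg r\<^esub> x)))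
    (obj (Spec (quot_alg (poly_alg r) I)) B) (obj (V_functor P E) B)"
    by (simp add: Spec_def comp_def)
  fix C :: "('k, 'u) module" and g \<phi>
  assume "comm_alg C" and g: "g \<in> alg_hom B C" and "\<phi> \<in> obj (Spec (quot_alg (poly_alg r) I)) B"
  then have C: "calg C" and \<phi>: "\<phi> \<in> alg_hom (quot_alg (poly_alg r) I) B"
    by (simp_all add: calgI Spec_def)
  have "compose (carrier (poly_alg r)) (compose (carrier (quot_alg (poly_alg r) I)) g \<phi>) (\<lambda>x. I +>\<^bsub>poly_alg r\<^esub> x)
    = compose (carrier (poly_alg r)) g (compose (carrier (poly_alg r)) \<phi> (\<lambda>x. I +>\<^bsub>poly_alg r\<^esub> x))"
    by (rule extensionalityI[OF compose_extensional compose_extensional])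
      (simp add: compose_eq quot.coset_mem)
  with based_tensor.basis_point_natural[OF based1[OF B] C g quot.compose_proj_hom[OF \<phi>]]
  show "basis_point (Hom P E E 1) r e C
      (compose (carrier (poly_alg r)) (arr (Spec (quot_alg (poly_alg r) I)) B C g \<phi>) (\<lambda>x. I +>\<^bsub>poly_alg r\<^esub> x))
    = arr (V_functor P E) B C g (basis_point (Hom P E E 1) r e B
      (compose (carrier (poly_alg r)) \<phi> (\<lambda>x. I +>\<^bsub>poly_alg r\<^esub> x)))"
    by (simp add: Spec_def V_functor_def)
qed

end

theorem proposition1:
  fixes P :: "('o, 'k::{alg_closed_field, field_char_0}, 'v) dg_data"
    and E :: 'o
    and r s :: nat
    and e f :: "nat \<Rightarrow> 'v"
    and a :: "nat \<Rightarrow> nat \<Rightarrow> nat \<Rightarrow> 'k"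
    and b :: "nat \<Rightarrow> nat \<Rightarrow> 'k"
  assumes "dg_category P"
    and "finite (Ob P)"
    and "\<forall>F\<in>Ob P. \<forall>G\<in>Ob P. \<forall>i. finite_dimensional (Hom P F G i)"
    and "\<exists>n>0. \<forall>F\<in>Ob P. \<forall>G\<in>Ob P. \<forall>i. i < - n \<longrightarrow> carrier (Hom P F G i) = {\<zero>\<^bsub>Hom P F G i\<^esub>}"
    and "E \<in> Ob P"
    and "is_basis (Hom P E E 1) r e"
    and "is_basis (Hom P E E 2) s f"
    and "\<forall>i\<in>{1..r}. \<forall>j\<in>{1..r}.
           cmp P E E E 1 1 (e i) (e j)
           = (\<Oplus>\<^bsub>Hom P E E 2\<^esub> l\<in>{1..s}. a i j l \<odot>\<^bsub>Hom P E E 2\<^esub> f l)"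
    and "\<forall>i\<in>{1..r}.
           diff P E E 1 (e i) = (\<Oplus>\<^bsub>Hom P E E 2\<^esub> l\<in>{1..s}. b i l \<odot>\<^bsub>Hom P E E 2\<^esub> f l)"
  shows
    "let V = (V_functor P E :: ('k, 'u, ('v \<times> 'u \<Rightarrow>\<^sub>0 int) set) set_functor);
         cb = (\<lambda>B :: ('k, 'u) module. courb P E r e s f B);
         cb_star = comorphism (poly_alg r) (courb P E r e s f);
         I = Idl\<^bsub>poly_alg r\<^esub> {cb_star (poly_var l) | l. l \<in> {1..s}}
     in natural_trans (Spec (poly_alg r)) (Spec (poly_alg s)) cb
      \<and> natural_iso (preimage_functor (Spec (poly_alg r)) cb (origin s)) V
          (basis_point (Hom P E E 1) r e)
      \<and> cb_star \<in> alg_hom (poly_alg s) (poly_alg r)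
      \<and> (\<forall>B p. comm_alg B \<and> p \<in> alg_hom (poly_alg r) B \<longrightarrow>
           cb B p = compose (carrier (poly_alg s)) p cb_star)
      \<and> (\<forall>l\<in>{1..s}. cb_star (poly_var l)
           = (\<Sum>i=1..r. poly_const (b i l) * poly_var i)
             + (\<Sum>i=1..r. \<Sum>j=1..r. poly_const (a i j l) * poly_var i * poly_var j))
      \<and> natural_iso (Spec (quot_alg (poly_alg r) I)) V
          (\<lambda>B \<phi>. basis_point (Hom P E E 1) r e B
                   (compose (carrier (poly_alg r)) \<phi> (\<lambda>x. I +>\<^bsub>poly_alg r\<^esub> x)))"
proof -
  interpret curvature_coordinates P E r s e f a b
    using assms by (simp add: curvature_coordinates_def curvature_coordinates_axioms_def)
  define cb_star where "cb_star = comorphism (poly_alg r) (courb P E r e s f)"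
  have var: "cb_star (poly_var l) = curvature_poly r a b l" if "l \<in> {1..s}" for l
    using comorphism_courb_var[OF that] by (simp add: cb_star_def)
  have gens: "{cb_star (poly_var l) | l. l \<in> {1..s}} = curvature_poly r a b ` {1..s}"
    using var by (auto simp: image_iff) metis+
  show ?thesis
    unfolding Let_def cb_star_def[symmetric] gens
  proof (intro conjI allI impI ballI)
    show "natural_trans (Spec (poly_alg r)) (Spec (poly_alg s)) (courb P E r e s f)"
      by (rule courb_natural)
    show "natural_iso (preimage_functor (Spec (poly_alg r)) (courb P E r e s f) (origin s))
        (V_functor P E) (basis_point (Hom P E E 1) r e)"
      by (rule preimage_origin_iso)
    show "cb_star \<in> alg_hom (poly_alg s) (poly_alg r)"
      unfolding cb_star_def by (rule comorphism_courb_hom)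
    show "courb P E r e s f B p = compose (carrier (poly_alg s)) p cb_star"
      if "comm_alg B \<and> p \<in> alg_hom (poly_alg r) B" for B :: "('k, 'u) module" and p
      unfolding cb_star_def by (rule courb_compose) (use that calgI in auto)
    show "cb_star (poly_var l) = (\<Sum>i=1..r. poly_const (b i l) * poly_var i)
        + (\<Sum>i=1..r. \<Sum>j=1..r. poly_const (a i j l) * poly_var i * poly_var j)"
      if "l \<in> {1..s}" for l
      using var[OF that] by (simp only: curvature_poly_def)
    show "natural_iso (Spec (quot_alg (poly_alg r) (Idl\<^bsub>poly_alg r\<^esub> (curvature_poly r a b ` {1..s}))))
        (V_functor P E)
        (\<lambda>B \<phi>. basis_point (Hom P E E 1) r e B (compose (carrier (poly_alg r)) \<phi>
          (\<lambda>x. Idl\<^bsub>poly_alg r\<^esub> (curvature_poly r a b ` {1..s}) +>\<^bsub>poly_alg r\<^esub> x)))"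
      by (rule quotient_iso)
  qed
qed

end
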